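(* Let $E$ be a Banach space, $\mathcal{E}$ the $\sigma$-algebra on $E$ generated by the balls, $E_0$ a closed separable subspace of $E$, and $F=E_0^*$, regarded as a space of linear functionals on $E$ such that $x\mapsto\langle x,\xi\rangle$ is $\mathcal{E}$-measurable for every $\xi\in F$. Let $\{a_n\}$ be a positive sequence with $a_n\to\infty$. Let $\Phi_n,\Phi:E\times F\to\mathbf{R}$ and let $Y_n$ be $E$-valued $\mathcal{E}$-measurable random vectors on probability spaces $(\Omega_n,\mathcal{A}_n,\mathbf{P}_n)$, and assume: 1. For all $\xi\in F$, $\Phi_n(\cdot,\xi)$ is $\mathcal{E}$-measurable. 2. For all $\xi\in F$, $\Phi(\cdot,\xi)$ is $\mathcal{E}$-measurable and continuous, and $\Phi(x,0)=0$ for all $x\in E$. 3. For all $\xi\in F$ and compact $K\subset E$, $\sup_{x\in K}|a_n^{-1}\Phi_n(x,a_n\xi)-\Phi(x,\xi)|\to0$. 4. For all $n$ and $\xi\in F$, $\mathbf{E}_n\exp[\langle Y_n,\xi\rangle-\Phi_n(Y_n,\xi)]=1$. 5. $\{\mathcal{L}_{\mathbf{P}_n}(Y_n)\}$ is exponentially tight. 6. For all $\xi\in F$, $\limsup_n\sup_{x\in E}|a_n^{-1}\Phi_n(x,a_n\xi)|<\infty$. 7. For every $x\in E$ with $\Phi^*(x,x)<\infty$ there is a neighborhood $U$ of $x$ such that for all $a\ge0$, $\bigcup_{y\in U}L(\Phi^*(y,\cdot),a)$ is a relatively compact subset of $E_0$. 8. If $x_n\to x$ in $E_0$ and $\xi_n\to\xi$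 weak-* in $F$, then $\Phi(x,\xi)\le\liminf_n\Phi(x_n,\xi_n)$. 9. For all $x\in E$, $\Phi(x,\cdot)$ is convex and $E_0$-Gâteaux differentiable on $F$; moreover for all $\xi\in F$, $x\in E_0$, the derivative $\phi_{x,\xi}'$ is continuous, where $\phi_{x,\xi}(t)=\Phi(x,t\xi)$, $t\in\mathbf{R}$. 10. For all $\xi\in F$, the equation $x=\nabla\Phi(x,\xi)$ has at most one solution $x\in E_0$. 11. For every $x_0$ with $\Phi^*(x_0,x_0)<\infty$ and every $\varepsilon>0$ there exists $y_0\in B(x_0,\varepsilon)$ such that (a) $\Phi^*(\cdot,y_0)$ is upper semicontinuous at $y_0$ as a function on $E_0$, and (b) $\Phi^*(y_0,y_0)\le\Phi^*(x_0,x_0)+\varepsilon$. Then for every $A\in\mathcal{E}$, $$\liminf_n a_n^{-1}\log\mathbf{P}_n\{Y_n\in A\}\ge-\inf_{x\in A^\circ}\Phi^*(x,x),$$ and the level sets $\{x\in E:\Phi^*(x,x)\le l\}$, $l\ge0$, are compact.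
   Context: $\Phi^*(x,y)=\sup_{\xi\in F}[\langle y,\xi\rangle-\Phi(x,\xi)]$ for $x,y\in E$. For $g:E\to\mathbf{R}^+$ and $a\ge0$, $L(g,a)=\{x\in E:g(x)\le a\}$. Exponential tightness: for every $b>0$ there is a compact $K\subset E$ with $\limsup_n a_n^{-1}\log\mathbf{P}_n\{Y_n\notin K\}\le-b$. A function $\phi:F\to\mathbf{R}$ is $E_0$-Gâteaux differentiable at $\xi$ if there is $\nabla\phi(\xi)\in E_0$ with $\langle\nabla\phi(\xi),\eta\rangle=\lim_{t\to0}t^{-1}[\phi(\xi+t\eta)-\phi(\xi)]$ for all $\eta\in F$; $\nabla\Phi(x,\xi)$ denotes the gradient of $\Phi(x,\cdot)$ at $\xi$. $B(x,\varepsilon)$ is the open ball in $E$; $A^\circ$ is the interior of $A$; weak-* convergence in $F=E_0^*$ is with respect to $E_0$. *)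

theory Defs
  imports "HOL-Probability.Probability"
begin

definition ball_sigma :: "'e::metric_space measure" where
  "ball_sigma = sigma UNIV {ball x r | x r. True}"

definition phistar :: "('e \<Rightarrow> real) set \<Rightarrow> ('e \<Rightarrow> ('e \<Rightarrow> real) \<Rightarrow> real) \<Rightarrow> 'e \<Rightarrow> 'e \<Rightarrow> ereal" where
  "phistar F Phi x y = (SUP \<xi>\<in>F. ereal (\<xi> y - Phi x \<xi>))"

definition elog :: "real \<Rightarrow> ereal" where
  "elog p = (if p = 0 then -\<infinity> else ereal (ln p))"

definition gateaux_has_grad ::
  "('e \<Rightarrow> real) set \<Rightarrow> 'e set \<Rightarrow> (('e \<Rightarrow> real) \<Rightarrow> real) \<Rightarrow> ('e \<Rightarrow> real) \<Rightarrow> 'e \<Rightarrow> bool" where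
  "gateaux_has_grad F E0 \<phi> \<xi> g \<longleftrightarrow> g \<in> E0 \<and>
     (\<forall>\<eta>\<in>F. ((\<lambda>t. (\<phi> (\<lambda>y. \<xi> y + t * \<eta> y) - \<phi> \<xi>) / t) \<longlongrightarrow> \<eta> g) (at 0))"

definition gateaux_differentiable ::
  "('e \<Rightarrow> real) set \<Rightarrow> 'e set \<Rightarrow> (('e \<Rightarrow> real) \<Rightarrow> real) \<Rightarrow> ('e \<Rightarrow> real) \<Rightarrow> bool" where
  "gateaux_differentiable F E0 \<phi> \<xi> \<longleftrightarrow> (\<exists>g. gateaux_has_grad F E0 \<phi> \<xi> g)"

definition gateaux_grad ::
  "('e \<Rightarrow> real) set \<Rightarrow> 'e set \<Rightarrow> (('e \<Rightarrow> real) \<Rightarrow> real) \<Rightarrow> ('e \<Rightarrow> real) \<Rightarrow> 'e" where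
  "gateaux_grad F E0 \<phi> \<xi> = (SOME g. gateaux_has_grad F E0 \<phi> \<xi> g)"

definition exp_tight :: "(nat \<Rightarrow> 'w measure) \<Rightarrow> (nat \<Rightarrow> 'w \<Rightarrow> 'e::metric_space) \<Rightarrow> (nat \<Rightarrow> real) \<Rightarrow> bool" where
  "exp_tight M Y a \<longleftrightarrow> (\<forall>b>0. \<exists>K. compact K \<and>
     limsup (\<lambda>n. ereal (1 / a n) * elog (measure (M n) {\<omega>\<in>space (M n). Y n \<omega> \<notin> K})) \<le> ereal (- b))"

end

theory Submission
  imports Defs
begin

text \<open>
  Tilting the law of \<open>Y n\<close> by \<open>exp (a n * \<xi> - Phin n _ (a n * \<xi>))\<close> gives a probability measure which,
  off the solutions of \<open>x = grad Phi(x, _)(\<xi>)\<close>, is exponentially small on compact sets; as there is at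
  most one solution, the tilted laws concentrate at it, and undoing the tilt yields the lower
  bound with rate \<open>\<xi> x - Phi x \<xi> = Phi* x x\<close> at such a point \<open>x\<close>.

  It remains to find such points near the \<open>y0\<close> of assumption 11. For \<open>x \<in> E0\<close> near \<open>y0\<close> let \<open>\<xi>(x)\<close> be the
  maximiser of \<open>\<xi> y0 - Phi x \<xi>\<close>, minus a small quadratic term, over a large finite-dimensional
  subspace of \<open>F\<close>. Upper semicontinuity of \<open>Phi* _ y0\<close> bounds the maximum, so \<open>grad Phi(x, _)(\<xi>(x))\<close>
  stays in one of the compact sets of assumption 7 and is weakly, hence in norm, close to \<open>y0\<close>.
  Schauder's theorem then gives a fixed point \<open>x = grad Phi(x, _)(\<xi>(x))\<close>, and \<open>Phi* x x \<le> Phi* x y0\<close> there.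
\<close>

section \<open>Automatic continuity of measurable functionals\<close>

text \<open>Two gaps lie between the hypotheses and the argument. Functionals in \<open>F\<close>
  are only known to be measurable off \<open>E0\<close>, while the tilting argument covers compact
  sets that may leave \<open>E0\<close> by open sets defined through them; hence the automatic
  continuity theorem. And \<open>F\<close> must separate points of \<open>E0\<close>, which comes
  from a functional on all of \<open>E\<close>, restricted to \<open>E0\<close> and represented in
  \<open>F\<close>.

  Fixed points enter because finiteness of \<open>phistar F Phi y0 y0\<close> does not make the
  supremum attained, and moving the point so that it is attained also changes the function
  \<open>Phi x\<close>. Only joint lower semicontinuity is available, and \<open>F\<close> may be
  infinite-dimensional. Over finitely many directions bounded coefficients are compact and their
  convergence gives weak-* convergence, so maximisers exist and pass to limits. The penalty makes
  them unique at the price of missing \<open>y0\<close> by at most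
  \<open>sqrt (2 * l * \<delta>)\<close> in each chosen direction, which a small
  \<open>\<delta>\<close> absorbs.\<close>

abbreviation coin :: "bool measure" where
  "coin \<equiv> uniform_count_measure UNIV"

lemma measurable_flip_coin:
  fixes k :: nat
  shows "(\<lambda>s. s(k := \<not> s k)) \<in> measurable (PiM UNIV (\<lambda>_. coin)) (PiM UNIV (\<lambda>_. coin))"
proof (rule measurable_PiM_single')
  fix i :: nat
  have 1: "(\<lambda>s. s i) \<in> measurable (PiM UNIV (\<lambda>_. coin)) coin" for i :: nat
    by (rule measurable_component_singleton) auto
  have 2: "Not \<in> measurable coin coin"
    by (auto simp: measurable_def sets_uniform_count_measure space_uniform_count_measure)
  show "(\<lambda>s. (s(k := \<not> s k)) i) \<in> measurable (PiM UNIV (\<lambda>_. coin)) coin"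
    using 1[of i] measurable_compose[OF 1[of k] 2] by (cases "i = k") auto
qed (auto simp: space_PiM space_uniform_count_measure)

text \<open>Cylinders determine the product measure. On a cylinder the flip only replaces the
  \<open>k\<close>-th factor by its preimage under negation, which has the same cardinality and so
  the same fair-coin mass.\<close>

lemma distr_flip_coin:
  fixes k :: nat
  defines "P \<equiv> PiM UNIV (\<lambda>_::nat. coin)"
  shows "distr P P (\<lambda>s. s(k := \<not> s k)) = P"
proof -
  interpret B: prob_space coin
    by (rule prob_space_uniform_count_measure) auto
  interpret product_prob_space "\<lambda>_::nat. coin" UNIV ..
  have sB: "A \<in> sets coin" for A
    by (simp add: sets_uniform_count_measure)
  show ?thesis
    unfolding P_def
  proof (rule PiM_eq, goal_cases)
    case (2 J F)
    let ?F = "\<lambda>j. if j = k then Not -` F j else F j"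
    have "(\<lambda>s. s(k := \<not> s k)) -` prod_emb UNIV (\<lambda>_. coin) J (Pi\<^sub>E J F) \<inter> space P
        = prod_emb UNIV (\<lambda>_. coin) J (Pi\<^sub>E J ?F)"
      by (auto simp: prod_emb_def P_def space_PiM space_uniform_count_measure PiE_iff
          split: if_splits)
    moreover have "prod_emb UNIV (\<lambda>_. coin) J (Pi\<^sub>E J F) \<in> sets P"
      unfolding P_def using 2 by (intro sets_PiM_I) auto
    ultimately have "emeasure (distr P P (\<lambda>s. s(k := \<not> s k))) (prod_emb UNIV (\<lambda>_. coin) J (Pi\<^sub>E J F))
       = emeasure P (prod_emb UNIV (\<lambda>_. coin) J (Pi\<^sub>E J ?F))"
      by (simp add: emeasure_distr measurable_flip_coin P_def)
    also have "\<dots> = (\<Prod>j\<in>J. emeasure coin (?F j))"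
      unfolding P_def using 2 by (subst emeasure_PiM_emb) (auto intro: sB)
    also have "\<dots> = (\<Prod>j\<in>J. emeasure coin (F j))"
    proof (rule prod.cong[OF refl])
      fix j
      have "card (Not -` F j) = card (F j)"
        by (rule card_vimage_inj) (auto simp: inj_def surj_def intro: exI[of _ "\<not> _"])
      then show "emeasure coin (?F j) = emeasure coin (F j)"
        by (auto simp: emeasure_uniform_count_measure)
    qed
    finally show ?case
      unfolding P_def .
  qed simp
qed

lemma ball_in_ball_sigma [measurable]: "ball x r \<in> sets ball_sigma"
  unfolding ball_sigma_def by (auto intro!: sigma_sets.Basic)

lemma space_ball_sigma [simp]: "space ball_sigma = UNIV"
  unfolding ball_sigma_def by (simp add: space_measure_of_conv)

text \<open>If \<open>f\<close> were unbounded, pick \<open>norm (x k) \<le> 2^-k\<close> with \<open>\<bar>f (x k)\<bar> > k\<close>. The random sum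
  of the \<open>x k\<close> over a subset chosen by coin flips turns \<open>f\<close> into a random variable which is
  bounded by some \<open>R\<close> with probability above \<open>1/2\<close>; flipping the \<open>k\<close>-th coin preserves the
  measure and changes its value by \<open>\<plusminus> f (x k)\<close>, so \<open>\<bar>f (x k)\<bar> \<le> 2 * R\<close>.\<close>

lemma linear_measurable_imp_bounded_linear:
  fixes f :: "'e::banach \<Rightarrow> real"
  assumes lin: "linear f" and meas: "f \<in> borel_measurable ball_sigma"
  shows "bounded_linear f"
proof (rule ccontr)
  assume "\<not> bounded_linear f"
  then have unb: "\<exists>x. \<bar>f x\<bar> > norm x * K" for K
    using lin unfolding bounded_linear_def bounded_linear_axioms_def by (auto simp: not_le)
  have "\<exists>x. norm x \<le> (1/2)^k \<and> \<bar>f x\<bar> > real k" for k :: nat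
  proof -
    \<comment> \<open>The factor \<open>2^k\<close> pays for rescaling \<open>x\<close> to norm
      \<open>(1/2)^k\<close>, which makes every subseries of the chosen vectors converge.\<close>
    obtain x where x: "\<bar>f x\<bar> > norm x * (real k * 2^k)"
      using unb by blast
    have "x \<noteq> 0"
      using x linear_0[OF lin] by auto
    define y where "y = ((1/2)^k / norm x) *\<^sub>R x"
    have "norm y = (1/2)^k"
      using \<open>x \<noteq> 0\<close> by (simp add: y_def)
    moreover have "\<bar>f y\<bar> = (1/2)^k / norm x * \<bar>f x\<bar>"
      by (simp add: y_def linear_scale[OF lin] abs_mult)
    moreover have "(1/2)^k / norm x * \<bar>f x\<bar> > real k"
      using x \<open>x \<noteq> 0\<close> by (simp add: field_simps)
    ultimately show ?thesis by (intro exI[of _ y]) auto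
  qed
  then obtain x where nx: "\<And>k. norm (x k) \<le> (1/2)^k" and fx: "\<And>k::nat. \<bar>f (x k)\<bar> > real k"
    by metis
  define P where "P = PiM UNIV (\<lambda>_::nat. coin)"
  interpret B: prob_space coin
    by (rule prob_space_uniform_count_measure) auto
  interpret PP: product_prob_space "\<lambda>_::nat. coin" UNIV ..
  interpret P: prob_space P
    unfolding P_def by unfold_locales
  have spaceP: "space P = UNIV"
    by (auto simp: P_def space_PiM space_uniform_count_measure)
  define t where "t s k = (if s k then x k else 0)" for s :: "nat \<Rightarrow> bool" and k
  define X where "X s = suminf (t s)" for s
  have sm: "summable (t s)" for s
  proof (rule summable_comparison_test'[where N = 0 and g = "\<lambda>k. (1/2)^k"])
    show "norm (t s n) \<le> (1/2)^n" for n
      using nx[of n] by (auto simp: t_def)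
  qed simp
  have coord: "{s. s k} \<in> sets P" for k
  proof -
    have "(\<lambda>s. s k) -` {True} \<inter> space P \<in> sets P"
      unfolding P_def
      by (rule measurable_sets[OF measurable_component_singleton])
        (auto simp: sets_uniform_count_measure)
    then show ?thesis
      by (simp add: spaceP vimage_def)
  qed
  \<comment> \<open>Measurability is tested through distances to all centres at once: adding
    \<open>x n\<close> amounts to shifting the centre, so measurability of addition is never
    invoked. This is why the induction leaves \<open>c\<close> arbitrary.\<close>
  have partial: "(\<lambda>s. dist c (\<Sum>k<n. t s k)) \<in> borel_measurable P" for c n
  proof (induction n arbitrary: c)
    case (Suc n)
    have "(\<lambda>s. dist c (\<Sum>k<Suc n. t s k)) =
       (\<lambda>s. if s n then dist (c - x n) (\<Sum>k<n. t s k) else dist c (\<Sum>k<n. t s k))"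
      by (auto simp: t_def dist_norm algebra_simps)
    moreover have "\<dots> \<in> borel_measurable P"
      by (rule measurable_If[OF Suc Suc]) (use coord in \<open>simp add: spaceP\<close>)
    ultimately show ?case by simp
  qed simp
  have dX: "(\<lambda>s. dist c (X s)) \<in> borel_measurable P" for c
    by (rule borel_measurable_LIMSEQ_real[OF _ partial[of c]])
       (auto simp: X_def intro!: tendsto_dist summable_LIMSEQ[OF sm])
  have Xm: "X \<in> measurable P ball_sigma"
    unfolding ball_sigma_def
  proof (rule measurable_measure_of)
    fix A :: "'e set"
    assume "A \<in> {ball x r |x r. True}"
    then obtain c r where "A = ball c r" by auto
    then have "X -` A \<inter> space P = {s \<in> space P. dist c (X s) < r}"
      by auto
    then show "X -` A \<inter> space P \<in> sets P"
      using dX[of c] by simp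
  qed auto
  define g where "g s = f (X s)" for s
  have gm [measurable]: "g \<in> borel_measurable P"
    unfolding g_def using measurable_compose[OF Xm meas] .
  define A where "A R = {s \<in> space P. \<bar>g s\<bar> \<le> real R}" for R :: nat
  have Am [measurable]: "A R \<in> sets P" for R
    unfolding A_def by measurable
  have "(\<lambda>R. P.prob (A R)) \<longlonglongrightarrow> P.prob (\<Union>R. A R)"
    by (rule P.finite_Lim_measure_incseq) (auto simp: incseq_def A_def)
  moreover have "(\<Union>R. A R) = space P"
    by (auto simp: A_def intro: real_arch_simple)
  ultimately have "(\<lambda>R. P.prob (A R)) \<longlonglongrightarrow> 1"
    by (simp add: P.prob_space)
  then have "\<forall>\<^sub>F R in sequentially. P.prob (A R) > 1/2"
    by (rule order_tendstoD) auto
  then obtain R where R: "P.prob (A R) > 1/2"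
    by (auto simp: eventually_sequentially)
  obtain k :: nat where k: "real k > 2 * real R"
    using reals_Archimedean2 by blast
  let ?fl = "\<lambda>s::nat \<Rightarrow> bool. s(k := \<not> s k)"
  have flip: "distr P P ?fl = P"
    unfolding P_def by (rule distr_flip_coin)
  have flm: "?fl \<in> measurable P P"
    unfolding P_def by (rule measurable_flip_coin)
  let ?A' = "?fl -` A R \<inter> space P"
  have "P.prob ?A' = P.prob (A R)"
    by (subst (2) flip[symmetric]) (simp add: measure_distr[OF flm])
  moreover have "?A' \<in> sets P"
    using flm by measurable
  \<comment> \<open>Two events of probability above \<open>1/2\<close> cannot be disjoint.\<close>
  ultimately have "P.prob (A R \<inter> ?A') > 0"
    using P.finite_measure_Union'[of "A R" ?A'] P.prob_le_1[of "A R \<union> ?A'"] R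
      P.finite_measure_Diff'[of ?A' "A R"]
    by (simp add: Int_commute)
  then obtain s where s: "s \<in> A R" "?fl s \<in> A R"
    by (metis (no_types, lifting) Int_iff emeasure_empty equals0I less_irrefl measure_empty vimageE)
  have "t (?fl s) = (\<lambda>j. t s j + (if j = k then (if s k then - x k else x k) else 0))"
    by (auto simp: t_def)
  then have "X (?fl s) = X s + (\<Sum>j. if j = k then (if s k then - x k else x k) else 0)"
    unfolding X_def by (simp add: suminf_add[OF sm] sums_summable[OF sums_single])
  also have "\<dots> = X s + (if s k then - x k else x k)"
    using sums_unique[OF sums_single[of k "\<lambda>_. if s k then - x k else x k"]] by simp
  finally have "\<bar>f (x k)\<bar> = \<bar>g (?fl s) - g s\<bar>"
    by (auto simp: g_def linear_add[OF lin] linear_neg[OF lin])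
  also have "\<dots> \<le> 2 * real R"
    using s by (auto simp: A_def)
  finally show False
    using fx[of k] k by linarith
qed

section \<open>Separation of points by bounded functionals\<close>

text \<open>Homogeneity is asked only as an inequality, which is what infima inherit directly; using
  it for the inverse scalar as well gives equality.\<close>

definition sublinear :: "('a::real_normed_vector \<Rightarrow> real) \<Rightarrow> bool" where
  "sublinear p \<longleftrightarrow> (\<forall>x y. p (x + y) \<le> p x + p y) \<and> (\<forall>c>0. \<forall>x. p (c *\<^sub>R x) \<le> c * p x) \<and> p 0 = 0"

lemma sublinear_scale:
  assumes "sublinear p" "c > 0"
  shows "p (c *\<^sub>R x) = c * p x"
proof (rule antisym)
  show "p (c *\<^sub>R x) \<le> c * p x"
    using assms by (auto simp: sublinear_def)
  have "p (inverse c *\<^sub>R (c *\<^sub>R x)) \<le> inverse c * p (c *\<^sub>R x)"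
    using assms unfolding sublinear_def by (metis positive_imp_inverse_positive)
  then show "c * p x \<le> p (c *\<^sub>R x)"
    using \<open>c > 0\<close> by (simp add: field_simps)
qed

lemma sublinear_ge:
  assumes "sublinear p" "p \<le> norm"
  shows "- norm x \<le> p x"
proof -
  have "p (x + (- x)) \<le> p x + p (- x)" "p 0 = 0"
    using assms unfolding sublinear_def by blast+
  moreover have "p (- x) \<le> norm x"
    using le_funD[OF assms(2), of "- x"] by simp
  ultimately show ?thesis by simp
qed

text \<open>This perturbation shows that a minimal sublinear functional is additive.\<close>

lemma sublinear_perturb:
  fixes y :: "'a::real_normed_vector"
  fixes p :: "'a::real_normed_vector \<Rightarrow> real"
  assumes p: "sublinear p" and le: "p \<le> norm"
  defines "q \<equiv> \<lambda>x. INF t\<in>{0::real..}. p (x + t *\<^sub>R y) - t * p y"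
  shows "sublinear q" "q \<le> p" "q x \<le> p (x + y) - p y"
proof -
  have sub: "p (x + z) \<le> p x + p z" for x z
    using p by (auto simp: sublinear_def)
  have sc: "c \<ge> 0 \<Longrightarrow> p (c *\<^sub>R x) = c * p x" for c x
    using sublinear_scale[OF p, of c x] p by (cases "c = 0") (auto simp: sublinear_def)
  have lower: "p (x + t *\<^sub>R y) - t * p y \<ge> - norm x" if "t \<ge> 0" for x t
  proof -
    have "t * p y \<le> p (x + t *\<^sub>R y) + p (- x)"
      using sub[of "x + t *\<^sub>R y" "- x"] sc[OF that] by simp
    moreover have "p (- x) \<le> norm x"
      using le_funD[OF le, of "- x"] by simp
    ultimately show ?thesis by simp
  qed
  have q_eq: "q x = (INF t\<in>{0::real..}. p (x + t *\<^sub>R y) - t * p y)" for x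
    by (simp only: q_def)
  have bdd: "bdd_below ((\<lambda>t. p (x + t *\<^sub>R y) - t * p y) ` {0..})" for x
    using lower by (intro bdd_belowI2[where m = "- norm x"]) auto
  have up: "q x \<le> p (x + t *\<^sub>R y) - t * p y" if "t \<ge> 0" for x t
    unfolding q_def using that by (intro cINF_lower bdd) auto
  show qp: "q \<le> p"
    using up[of 0] by (auto simp: le_fun_def)
  show "q x \<le> p (x + y) - p y"
    using up[of 1 x] by simp
  have add: "q (x + z) \<le> q x + q z" for x z
  proof -
    have "q (x + z) - (p (x + t *\<^sub>R y) - t * p y) \<le> q z" if "t \<ge> 0" for t
      unfolding q_eq[of z]
    proof (rule cINF_greatest)
      fix s :: real assume "s \<in> {0..}"
      then have "q (x + z) \<le> p ((x + t *\<^sub>R y) + (z + s *\<^sub>R y)) - (t + s) * p y"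
        using up[of "t + s" "x + z"] that by (simp add: algebra_simps)
      also have "\<dots> \<le> (p (x + t *\<^sub>R y) - t * p y) + (p (z + s *\<^sub>R y) - s * p y)"
        using sub[of "x + t *\<^sub>R y" "z + s *\<^sub>R y"] by (simp add: algebra_simps)
      finally show "q (x + z) - (p (x + t *\<^sub>R y) - t * p y) \<le> p (z + s *\<^sub>R y) - s * p y"
        by simp
    qed simp
    then have "q (x + z) - q z \<le> q x"
      unfolding q_eq[of x] by (intro cINF_greatest) (auto simp: algebra_simps)
    then show ?thesis by simp
  qed
  have scale: "q (c *\<^sub>R x) \<le> c * q x" if "c > 0" for c x
  proof -
    have "q (c *\<^sub>R x) / c \<le> q x"
      unfolding q_eq[of x]
    proof (rule cINF_greatest)
      fix t :: real assume t: "t \<in> {0..}"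
      have "q (c *\<^sub>R x) \<le> p (c *\<^sub>R (x + t *\<^sub>R y)) - c * t * p y"
        using up[of "c * t" "c *\<^sub>R x"] t that by (simp add: scaleR_add_right)
      then have "q (c *\<^sub>R x) \<le> c * (p (x + t *\<^sub>R y) - t * p y)"
        using that sc[of c "x + t *\<^sub>R y"] by (simp add: right_diff_distrib)
      then show "q (c *\<^sub>R x) / c \<le> p (x + t *\<^sub>R y) - t * p y"
        using that by (simp add: divide_le_eq mult.commute)
    qed simp
    then show ?thesis
      using that by (simp add: field_simps)
  qed
  have "q 0 = 0"
  proof (rule antisym)
    show "q 0 \<le> 0"
      using le_funD[OF qp, of 0] p by (simp add: sublinear_def)
    show "0 \<le> q 0"
      unfolding q_def using lower[of _ 0] by (intro cINF_greatest) auto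
  qed
  then show "sublinear q"
    using add scale by (auto simp: sublinear_def)
qed

text \<open>The chain condition gives subadditivity: if \<open>p\<close> is used at \<open>x\<close>
  and \<open>q\<close> at \<open>z\<close>, the smaller of the two serves at both points. The bound
  by \<open>norm\<close> keeps the infimum finite.\<close>

lemma sublinear_INF:
  assumes C: "C \<noteq> {}" "\<And>p. p \<in> C \<Longrightarrow> sublinear p" "\<And>p. p \<in> C \<Longrightarrow> p \<le> norm"
    and chain: "\<And>p q. p \<in> C \<Longrightarrow> q \<in> C \<Longrightarrow> p \<le> q \<or> q \<le> p"
  defines "u \<equiv> \<lambda>x::'a::real_normed_vector. INF p\<in>C. p x"
  shows "sublinear u" "p \<in> C \<Longrightarrow> u \<le> p"
proof -
  have u_eq: "u x = (INF p\<in>C. p x)" for x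
    by (simp only: u_def)
  have bdd: "bdd_below ((\<lambda>p. p x) ` C)" for x
    using sublinear_ge C(2,3) by (intro bdd_belowI2[where m = "- norm x"]) auto
  have up: "u x \<le> p x" if "p \<in> C" for x p
    unfolding u_def using that by (intro cINF_lower bdd)
  then show "p \<in> C \<Longrightarrow> u \<le> p"
    by (auto simp: le_fun_def)
  have add: "u (x + z) \<le> u x + u z" for x z
  proof -
    have "u (x + z) - p x \<le> u z" if p: "p \<in> C" for p
      unfolding u_eq[of z]
    proof (rule cINF_greatest[OF C(1)])
      fix q assume q: "q \<in> C"
      define r where "r = (if p \<le> q then p else q)"
      have r: "r \<in> C" "r x \<le> p x" "r z \<le> q z"
        using chain[OF p q] p q by (auto simp: r_def le_fun_def)
      have "u (x + z) \<le> r (x + z)"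
        by (rule up[OF r(1)])
      also have "\<dots> \<le> r x + r z"
        using C(2)[OF r(1)] by (auto simp: sublinear_def)
      finally show "u (x + z) - p x \<le> q z"
        using r by simp
    qed
    then have "u (x + z) - u z \<le> u x"
      unfolding u_eq[of x] by (intro cINF_greatest[OF C(1)]) (auto simp: algebra_simps)
    then show ?thesis by simp
  qed
  have scale: "u (c *\<^sub>R x) \<le> c * u x" if "c > 0" for c x
  proof -
    have "u (c *\<^sub>R x) / c \<le> u x"
      unfolding u_eq[of x]
    proof (rule cINF_greatest[OF C(1)])
      fix p assume p: "p \<in> C"
      have "u (c *\<^sub>R x) \<le> c * p x"
        using up[OF p, of "c *\<^sub>R x"] sublinear_scale[OF C(2)[OF p] that] by simp
      then show "u (c *\<^sub>R x) / c \<le> p x"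
        using that by (simp add: field_simps)
    qed
    then show ?thesis
      using that by (simp add: field_simps)
  qed
  have "u 0 = (INF p\<in>C. 0)"
    unfolding u_def by (rule INF_cong) (use C(2) in \<open>auto simp: sublinear_def\<close>)
  then show "sublinear u"
    using add scale C(1) by (auto simp: sublinear_def)
qed

text \<open>Zorn's lemma for the reversed pointwise order; a nonempty chain is bounded by its
  pointwise infimum.\<close>

lemma exists_minimal_sublinear:
  assumes p: "sublinear p" "p \<le> norm"
  obtains m where "sublinear m" "m \<le> p" "\<And>q. sublinear q \<Longrightarrow> q \<le> m \<Longrightarrow> q = m"
proof -
  let ?A = "{q. sublinear q \<and> q \<le> p}"
  let ?P = "\<lambda>a b. b \<le> (a :: 'a \<Rightarrow> real)"
  have "\<exists>m\<in>?A. \<forall>a\<in>?A. ?P m a \<longrightarrow> a = m"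
  proof (rule predicate_Zorn)
    show "partial_order_on ?A (relation_of ?P ?A)"
      by (rule partial_order_on_relation_ofI) auto
    fix C assume C: "C \<in> Chains (relation_of ?P ?A)"
    then have CA: "C \<subseteq> ?A"
      by (auto simp: Chains_def relation_of_def)
    have chain: "a \<le> b \<or> b \<le> a" if "a \<in> C" "b \<in> C" for a b
      using C that by (auto simp: Chains_def relation_of_def)
    show "\<exists>u\<in>?A. \<forall>a\<in>C. u \<le> a"
    proof (cases "C = {}")
      case True
      then show ?thesis using p by auto
    next
      case False
      note u = sublinear_INF[OF False _ _ chain]
      have 1: "sublinear (\<lambda>x. INF p\<in>C. p x)"
        by (rule u) (use CA p(2) in auto)
      have 2: "(\<lambda>x. INF p\<in>C. p x) \<le> a" if "a \<in> C" for a
        by (rule u) (use CA p(2) that in auto)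
      obtain a where "a \<in> C" using False by auto
      then have "(\<lambda>x. INF p\<in>C. p x) \<le> p"
        using 2[of a] CA by (auto intro: order_trans)
      with 1 2 show ?thesis by blast
    qed
  qed
  then obtain m where m: "sublinear m" "m \<le> p" "\<forall>a\<in>?A. a \<le> m \<longrightarrow> a = m"
    by auto
  show ?thesis
    by (rule that[OF m(1,2)]) (use m in \<open>auto intro: order_trans\<close>)
qed

text \<open>By minimality the perturbation in direction \<open>y\<close> is \<open>m\<close> itself,
  and its value at \<open>x\<close> is at most \<open>m (x + y) - m y\<close>. This is the missing
  half of additivity, which in turn yields negative scalars.\<close>

lemma minimal_sublinear_linear:
  assumes m: "sublinear m" "m \<le> norm" and min: "\<And>q. sublinear q \<Longrightarrow> q \<le> m \<Longrightarrow> q = m"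
  shows "linear m"
proof -
  have add: "m (x + y) = m x + m y" for x y
  proof (rule antisym)
    note q = sublinear_perturb[OF m, where y = y]
    have "(INF t\<in>{0::real..}. m (x + t *\<^sub>R y) - t * m y) = m x"
      by (rule fun_cong[OF min[OF q(1,2)]])
    then show "m x + m y \<le> m (x + y)"
      using q(3)[where x = x] by linarith
  qed (use m in \<open>auto simp: sublinear_def\<close>)
  have zero: "m 0 = 0"
    using m by (simp add: sublinear_def)
  have neg: "m (- x) = - m x" for x
    using add[of x "- x"] zero by simp
  have "m (c *\<^sub>R x) = c * m x" for c x
  proof (cases c "0::real" rule: linorder_cases)
    case less
    then show ?thesis
      using sublinear_scale[OF m(1), of "- c" x] neg[of "c *\<^sub>R x"] by simp
  qed (use zero sublinear_scale[OF m(1)] in auto)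
  with add show ?thesis
    by (intro linearI) auto
qed

text \<open>The minimal functional is sought below the perturbation of \<open>norm\<close> in
  direction \<open>x\<close>, not below \<open>norm\<close>: that perturbation is at most
  \<open>- norm x\<close> at \<open>- x\<close>, so a linear functional below it is at least
  \<open>norm x\<close> at \<open>x\<close>.\<close>

lemma exists_bounded_linear_nonzero:
  fixes x :: "'a::real_normed_vector"
  assumes "x \<noteq> 0"
  obtains f :: "'a \<Rightarrow> real" where "bounded_linear f" "f x \<noteq> 0"
proof -
  have n: "sublinear (norm :: 'a \<Rightarrow> real)"
    by (auto simp: sublinear_def norm_triangle_ineq)
  note q = sublinear_perturb[OF n order_refl, where y = x]
  obtain m where m: "sublinear m" "m \<le> (\<lambda>z. INF t\<in>{0::real..}. norm (z + t *\<^sub>R x) - t * norm x)"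
    and min: "\<And>q. sublinear q \<Longrightarrow> q \<le> m \<Longrightarrow> q = m"
    by (rule exists_minimal_sublinear[OF q(1) q(2)]) blast
  have mn: "m \<le> norm"
    using m(2) q(2) by (rule order_trans)
  have lin: "linear m"
    by (rule minimal_sublinear_linear[OF m(1) mn min])
  have "\<bar>m z\<bar> \<le> norm z" for z
    using sublinear_ge[OF m(1) mn, of z] le_funD[OF mn, of z] by simp
  then have "bounded_linear m"
    using lin by (auto simp: bounded_linear_def bounded_linear_axioms_def intro!: exI[of _ 1])
  moreover have "m (- x) \<le> - norm x"
    using le_funD[OF m(2), of "- x"] q(3)[where x = "- x"] by simp
  then have "m x \<noteq> 0"
    using assms linear_neg[OF lin, of x] by auto
  ultimately show ?thesis ..
qed

section \<open>Brouwer and Schauder fixed points\<close>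

lemma compact_PiE_UNIV:
  fixes S :: "'i \<Rightarrow> 'b::topological_space set"
  assumes "\<And>i. compact (S i)"
  shows "compact (Pi\<^sub>E UNIV S)"
proof -
  have "compactin (product_topology (\<lambda>_. euclidean) UNIV) (Pi\<^sub>E UNIV S)"
    using assms by (simp add: compactin_PiE)
  then show ?thesis
    by (simp add: euclidean_product_topology)
qed

lemma tendsto_fun_component:
  assumes "(f \<longlongrightarrow> l) F"
  shows "((\<lambda>x. f x i) \<longlongrightarrow> (l i :: 'b::topological_space)) F"
  by (rule continuous_on_tendsto_compose[where s = UNIV and f = "\<lambda>g. g i", OF _ assms]) simp_all

lemma tendsto_fun_componentwise:
  assumes "\<And>i. ((\<lambda>x. f x i) \<longlongrightarrow> (l i :: 'b::topological_space)) F"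
  shows "(f \<longlongrightarrow> l) F"
proof -
  have "limitin (product_topology (\<lambda>_. euclidean) UNIV) f l F"
    using assms by (subst limitin_componentwise) auto
  then show ?thesis
    by (simp add: euclidean_product_topology)
qed

text \<open>The dimension is a term because it will be the size of a finite net. Pinning the
  remaining coordinates to 0 makes the cube compact in the product topology.\<close>

definition unit_cube :: "nat \<Rightarrow> (nat \<Rightarrow> real) set" where
  "unit_cube n = {s. (\<forall>i<n. 0 \<le> s i \<and> s i \<le> 1) \<and> (\<forall>i\<ge>n. s i = 0)}"

lemma compact_unit_cube: "compact (unit_cube n)"
proof -
  have "unit_cube n = Pi\<^sub>E UNIV (\<lambda>i. if i < n then {0..1} else {0})"
    by (auto simp: unit_cube_def PiE_iff split: if_splits)
  then show ?thesis
    by (auto intro: compact_PiE_UNIV)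
qed

text \<open>Kuhn's combinatorial lemma on grids of mesh \<open>1 / Suc p\<close> yields cells in
  which every coordinate \<open>i\<close> has vertices of both labels, that is, of both signs of
  \<open>f s i - s i\<close>. Where such cells accumulate, continuity forces equality.\<close>

lemma brouwer_unit_cube:
  fixes f :: "(nat \<Rightarrow> real) \<Rightarrow> nat \<Rightarrow> real"
  assumes cont: "\<And>i. i < n \<Longrightarrow> continuous_on (unit_cube n) (\<lambda>s. f s i)"
    and maps: "\<And>s i. s \<in> unit_cube n \<Longrightarrow> i < n \<Longrightarrow> f s i \<in> {0..1}"
  obtains s where "s \<in> unit_cube n" "\<And>i. i < n \<Longrightarrow> f s i = s i"
proof -
  define z where "z p x = (\<lambda>i. if i < n then real (x i) / real (Suc p) else 0)" for p x
  have zmem: "z p x \<in> unit_cube n" if "\<forall>i<n. x i \<le> Suc p" for p x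
    using that by (auto simp: z_def unit_cube_def simp del: of_nat_Suc)
  \<comment> \<open>On the face \<open>x i = Suc p\<close> Kuhn's lemma demands label 1 even if
    \<open>f\<close> fixes that coordinate. This is consistent with \<open>label1\<close>, since
    there \<open>z p x i = 1\<close> and \<open>f\<close> is at most 1.\<close>
  define label where
    "label p x i = (if x i \<noteq> Suc p \<and> f (z p x) i \<ge> z p x i then 0 else 1 :: nat)" for p x i
  have label0: "f (z p x) i \<ge> z p x i" if "label p x i = 0" for p x i
    using that by (auto simp: label_def split: if_splits)
  have label1: "f (z p x) i \<le> z p x i" if "label p x i \<noteq> 0" "i < n" "\<forall>i<n. x i \<le> Suc p" for p x i
  proof (cases "x i = Suc p")
    case True
    then have "z p x i = 1"
      using that by (simp add: z_def)
    then show ?thesis using maps[OF zmem[OF that(3)] that(2)] by auto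
  qed (use that in \<open>auto simp: label_def split: if_splits\<close>)
  define near where "near q x \<longleftrightarrow> (\<forall>j<n. q j \<le> x j \<and> x j \<le> q j + 1)" for q x :: "nat \<Rightarrow> nat"
  have "\<exists>q. (\<forall>i<n. q i < Suc p) \<and>
      (\<forall>i<n. \<exists>r s. near q r \<and> near q s \<and> label p r i \<noteq> label p s i)" for p
  proof -
    have 1: "\<forall>x. (\<forall>i<n. x i \<le> Suc p) \<longrightarrow> (\<forall>i<n. label p x i = 0 \<or> label p x i = 1)"
      by (auto simp: label_def)
    have 2: "\<forall>x. (\<forall>i<n. x i \<le> Suc p) \<longrightarrow> (\<forall>i<n. x i = 0 \<longrightarrow> label p x i = 0)"
      using maps[OF zmem] by (auto simp: label_def z_def)
    have 3: "\<forall>x. (\<forall>i<n. x i \<le> Suc p) \<longrightarrow> (\<forall>i<n. x i = Suc p \<longrightarrow> label p x i = 1)"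
      by (auto simp: label_def)
    show ?thesis
      unfolding near_def by (rule kuhn_lemma[OF zero_less_Suc 1 2 3]) blast
  qed
  then obtain q where q: "\<And>p. \<forall>i<n. q p i < Suc p" and
    qrs: "\<And>p i. i < n \<Longrightarrow> \<exists>r s. near (q p) r \<and> near (q p) s \<and> label p r i \<noteq> label p s i"
    by metis
  have "\<forall>p. z p (q p) \<in> unit_cube n"
    using q by (blast intro: zmem less_imp_le)
  then obtain w \<phi> where w: "w \<in> unit_cube n" and \<phi>: "strict_mono \<phi>"
    and lim: "((\<lambda>p. z p (q p)) \<circ> \<phi>) \<longlonglongrightarrow> w"
    by (rule seq_compactE[OF compact_imp_seq_compact[OF compact_unit_cube]])
  \<comment> \<open>Cells shrink, so any choice of one vertex per cell has the same limit; this is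
    applied to the vertices of either label.\<close>
  have lim_near: "(\<lambda>k. z (\<phi> k) (x k)) \<longlonglongrightarrow> w"
    if x: "\<And>k. near (q (\<phi> k)) (x k)" for x
  proof (rule tendsto_fun_componentwise)
    fix i
    have 1: "(\<lambda>k. z (\<phi> k) (q (\<phi> k)) i) \<longlonglongrightarrow> w i"
      using tendsto_fun_component[OF lim] by (simp add: o_def)
    have inv: "(\<lambda>k. inverse (real (Suc (\<phi> k)))) \<longlonglongrightarrow> 0"
      using LIMSEQ_subseq_LIMSEQ[OF LIMSEQ_inverse_real_of_nat \<phi>] by (simp add: o_def)
    have 2: "(\<lambda>k. z (\<phi> k) (q (\<phi> k)) i + inverse (real (Suc (\<phi> k)))) \<longlonglongrightarrow> w i"
      using tendsto_add[OF 1 inv] by simp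
    have "z (\<phi> k) (q (\<phi> k)) i \<le> z (\<phi> k) (x k) i \<and>
        z (\<phi> k) (x k) i \<le> z (\<phi> k) (q (\<phi> k)) i + inverse (real (Suc (\<phi> k)))" for k
    proof (cases "i < n")
      case True
      then have "real (q (\<phi> k) i) \<le> real (x k i)" "real (x k i) \<le> real (q (\<phi> k) i) + 1"
        using x[of k] by (auto simp: near_def le_Suc_eq)
      with True show ?thesis
        by (simp add: z_def divide_right_mono inverse_eq_divide del: of_nat_Suc flip: add_divide_distrib)
    qed (simp add: z_def)
    then show "(\<lambda>k. z (\<phi> k) (x k) i) \<longlonglongrightarrow> w i"
      by (intro tendsto_sandwich[OF _ _ 1 2]) auto
  qed
  have "f w i = w i" if i: "i < n" for i
  proof -
    have "\<exists>r s. near (q (\<phi> k)) r \<and> near (q (\<phi> k)) s \<and>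
        label (\<phi> k) r i = 0 \<and> label (\<phi> k) s i \<noteq> 0" for k
      using qrs[OF i, of "\<phi> k"] by (metis label_def)
    then obtain r s where
      r: "\<And>k. near (q (\<phi> k)) (r k)" and s: "\<And>k. near (q (\<phi> k)) (s k)" and
      l: "\<And>k. label (\<phi> k) (r k) i = 0" "\<And>k. label (\<phi> k) (s k) i \<noteq> 0"
      by metis
    have mem: "\<forall>j<n. x j \<le> Suc (\<phi> k)" if "near (q (\<phi> k)) x" for x k
      using that q[of "\<phi> k"] unfolding near_def by fastforce
    have lims: "(\<lambda>k. f (z (\<phi> k) (x k)) i) \<longlonglongrightarrow> f w i"
      if "\<And>k. near (q (\<phi> k)) (x k)" for x
      by (rule continuous_on_tendsto_compose[where f = "\<lambda>s. f s i", OF cont[OF i] lim_near[OF that] w])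
         (intro always_eventually allI zmem mem that)
    have "w i \<le> f w i"
      by (rule LIMSEQ_le[OF tendsto_fun_component[OF lim_near, of r] lims[of r]])
         (use label0 l r in auto)
    moreover have "f w i \<le> w i"
      by (rule LIMSEQ_le[OF lims[of s] tendsto_fun_component[OF lim_near, of s]])
         (use label1 l i s mem in auto)
    ultimately show ?thesis by simp
  qed
  with w show thesis using that by blast
qed

text \<open>A partition of unity on an \<open>e\<close>-net of \<open>K\<close> reduces this to Brouwer. Barycentric coordinates
  are only required to lie in the cube, the deficit of a sum below 1 being assigned to the
  base point \<open>z 0\<close>.\<close>

lemma schauder_approx:
  fixes g :: "'a::real_normed_vector \<Rightarrow> 'a"
  assumes D: "convex D" "D \<noteq> {}" and K: "compact K" "K \<subseteq> D"
    and cont: "continuous_on D g" and maps: "\<And>x. x \<in> D \<Longrightarrow> g x \<in> K" and e: "e > 0"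
  obtains x where "x \<in> D" "dist x (g x) \<le> e"
proof -
  have "K \<noteq> {}" using D maps by blast
  obtain Z where Z: "finite Z" "Z \<subseteq> K" "K \<subseteq> (\<Union>z\<in>Z. ball z e)"
    by (rule compactE_image[OF K(1), of K "\<lambda>z. ball z e"]) (use e in auto)
  obtain z :: "nat \<Rightarrow> 'a" and n where zn: "Z = z ` {..<n}"
    using finite_imp_nat_seg_image_inj_on[OF Z(1)] by (metis lessThan_def)
  have n0: "n > 0"
    using Z zn \<open>K \<noteq> {}\<close> by (cases n) auto
  have zD: "z i \<in> D" if "i < n" for i
    using that zn Z K by auto
  define u where "u y i = max 0 (e - dist y (z i))" for y i
  have u0: "u y i \<ge> 0" for y i by (simp add: u_def)
  have upos: "(\<Sum>i<n. u y i) > 0" if y: "y \<in> K" for y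
  proof -
    obtain i where "i < n" "dist y (z i) < e"
      using Z(3) zn y by (auto simp: dist_commute)
    then show ?thesis
      using u0 by (intro sum_pos2[of _ i]) (auto simp: u_def)
  qed
  \<comment> \<open>The maximum with 1 avoids division by zero and rescales only coordinates whose
    sum exceeds 1. At the fixed point the sum is exactly 1, so \<open>X\<close> is there a plain
    convex combination of net points.\<close>
  define T where "T s = max 1 (\<Sum>i<n. s i)" for s :: "nat \<Rightarrow> real"
  define X where "X s = z 0 + (\<Sum>i<n. (s i / T s) *\<^sub>R (z i - z 0))" for s
  have T1: "T s \<ge> 1" for s by (simp add: T_def)
  have X_sum: "X s = (\<Sum>i<n. (s i / T s + (if i = 0 then 1 - (\<Sum>i<n. s i / T s) else 0)) *\<^sub>R z i)" for s
    using n0 by (simp add: X_def scaleR_add_left scaleR_diff_right sum.distrib sum_subtractf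
       scaleR_left_diff_distrib if_distrib[where f = "\<lambda>c. c *\<^sub>R _"] scaleR_sum_left cong: if_cong)
  have XD: "X s \<in> D" if s: "s \<in> unit_cube n" for s
    unfolding X_sum
  proof (rule convex_sum)
    have "(\<Sum>i<n. s i / T s) = (\<Sum>i<n. s i) / T s"
      by (simp add: sum_divide_distrib)
    also have "\<dots> \<le> 1"
      using T1[of s] by (simp add: T_def)
    finally have "(\<Sum>i<n. s i / T s) \<le> 1" .
    then show "0 \<le> s i / T s + (if i = 0 then 1 - (\<Sum>i<n. s i / T s) else 0)"
      if "i \<in> {..<n}" for i
      using s T1[of s] that by (auto simp: unit_cube_def intro!: add_nonneg_nonneg divide_nonneg_nonneg)
  qed (use D zD n0 in \<open>auto simp: sum.distrib\<close>)
  have contc: "continuous_on S (\<lambda>s. s i)" for S :: "(nat \<Rightarrow> real) set" and i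
    by (rule continuous_on_subset[OF continuous_on_product_coordinates]) simp
  have contX: "continuous_on (unit_cube n) X"
  proof -
    have "max 1 a \<noteq> 0" for a :: real
      by (simp add: max_def)
    then show ?thesis
      unfolding X_def T_def by (intro continuous_intros contc) auto
  qed
  have contg: "continuous_on (unit_cube n) (\<lambda>s. g (X s))"
    using XD by (intro continuous_on_compose2[OF cont contX]) auto
  define f where "f s i = u (g (X s)) i / (\<Sum>j<n. u (g (X s)) j)" for s i
  have contf: "continuous_on (unit_cube n) (\<lambda>s. f s i)" for i
    unfolding f_def
  proof -
    have cu: "continuous_on (unit_cube n) (\<lambda>s. u (g (X s)) j)" for j
      unfolding u_def by (intro continuous_intros contg)
    have "(\<Sum>j<n. u (g (X s)) j) \<noteq> 0" if "s \<in> unit_cube n" for s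
      using upos[OF maps[OF XD[OF that]]] by simp
    then show "continuous_on (unit_cube n) (\<lambda>s. u (g (X s)) i / (\<Sum>j<n. u (g (X s)) j))"
      by (intro continuous_on_divide continuous_on_sum ballI cu)
  qed
  have f01: "f s i \<in> {0..1}" if "s \<in> unit_cube n" "i < n" for s i
  proof -
    have "u (g (X s)) i \<le> (\<Sum>j<n. u (g (X s)) j)"
      using that u0 by (intro member_le_sum) auto
    then show ?thesis
      using u0 upos[OF maps[OF XD[OF that(1)]]] by (auto simp: f_def)
  qed
  obtain s where s: "s \<in> unit_cube n" "\<And>i. i < n \<Longrightarrow> f s i = s i"
    by (rule brouwer_unit_cube[where f = f and n = n]) (use contf f01 in auto)
  define y where "y = g (X s)"
  have yK: "y \<in> K" using maps[OF XD[OF s(1)]] by (simp add: y_def)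
  have s_eq: "s i = u y i / (\<Sum>j<n. u y j)" if "i < n" for i
    using s(2)[OF that] by (simp add: f_def y_def)
  have "(\<Sum>i<n. s i) = (\<Sum>i<n. u y i) / (\<Sum>j<n. u y j)"
    unfolding sum_divide_distrib by (rule sum.cong) (simp_all add: s_eq)
  then have sum1: "(\<Sum>i<n. s i) = 1"
    using upos[OF yK] by simp
  then have "T s = 1" by (simp add: T_def)
  have "X s = (\<Sum>i<n. s i *\<^sub>R z i)"
    unfolding X_sum \<open>T s = 1\<close> div_by_1 sum1 by (rule sum.cong) auto
  moreover have "y = (\<Sum>i<n. s i *\<^sub>R y)"
    by (simp add: sum1 flip: scaleR_sum_left)
  ultimately have "X s - y = (\<Sum>i<n. s i *\<^sub>R (z i - y))"
    by (simp add: scaleR_diff_right sum_subtractf)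
  then have "norm (X s - y) \<le> (\<Sum>i<n. norm (s i *\<^sub>R (z i - y)))"
    by (simp only: norm_sum)
  \<comment> \<open>Net points at distance \<open>e\<close> or more from \<open>y\<close> have
    weight 0.\<close>
  also have "\<dots> \<le> (\<Sum>i<n. s i * e)"
  proof (rule sum_mono)
    fix i assume i: "i \<in> {..<n}"
    show "norm (s i *\<^sub>R (z i - y)) \<le> s i * e"
    proof (cases "dist y (z i) < e")
      case True
      then show ?thesis
        using s(1) i by (auto simp: unit_cube_def dist_norm norm_minus_commute intro!: mult_left_mono)
    next
      case False
      then show ?thesis using s_eq[of i] i by (simp add: u_def)
    qed
  qed
  also have "\<dots> = e"
    using sum1 by (metis mult_1 sum_distrib_right)
  finally show thesis
    using that[OF XD[OF s(1)]] by (simp add: dist_norm y_def)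
qed

text \<open>Images of approximate fixed points accumulate in the compact \<open>K\<close>. As
  \<open>K\<close> lies in \<open>D\<close>, continuity applies at the accumulation point, even if
  \<open>D\<close> is not closed.\<close>

theorem schauder_fixed_point:
  fixes g :: "'a::real_normed_vector \<Rightarrow> 'a"
  assumes D: "convex D" "D \<noteq> {}" and K: "compact K" "K \<subseteq> D"
    and cont: "continuous_on D g" and maps: "\<And>x. x \<in> D \<Longrightarrow> g x \<in> K"
  obtains x where "x \<in> D" "g x = x"
proof -
  have "\<exists>x. x \<in> D \<and> dist x (g x) \<le> inverse (real (Suc k))" for k
    using schauder_approx[OF assms, of "inverse (real (Suc k))"] by (metis inverse_positive_iff_positive of_nat_0_less_iff zero_less_Suc)
  then obtain x where x: "\<And>k. x k \<in> D" "\<And>k. dist (x k) (g (x k)) \<le> inverse (real (Suc k))"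
    by metis
  have "\<forall>k. g (x k) \<in> K"
    using x maps by blast
  then obtain y \<phi> where y: "y \<in> K" and \<phi>: "strict_mono \<phi>" and lim: "((\<lambda>k. g (x k)) \<circ> \<phi>) \<longlonglongrightarrow> y"
    by (rule seq_compactE[OF compact_imp_seq_compact[OF K(1)]])
  have "(\<lambda>k. dist (x (\<phi> k)) (g (x (\<phi> k)))) \<longlonglongrightarrow> 0"
  proof (rule tendsto_sandwich[OF _ _ tendsto_const])
    show "(\<lambda>k. inverse (real (Suc (\<phi> k)))) \<longlonglongrightarrow> 0"
      using LIMSEQ_subseq_LIMSEQ[OF LIMSEQ_inverse_real_of_nat \<phi>] by (simp add: o_def)
  qed (use x in auto)
  then have "(\<lambda>k. x (\<phi> k) - g (x (\<phi> k))) \<longlonglongrightarrow> 0"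
    by (simp add: dist_norm tendsto_norm_zero_iff)
  from tendsto_add[OF this lim] have "(\<lambda>k. x (\<phi> k)) \<longlonglongrightarrow> y"
    by (simp add: o_def)
  then have "(\<lambda>k. g (x (\<phi> k))) \<longlonglongrightarrow> g y"
    by (rule continuous_on_tendsto_compose[OF cont]) (use x y K in auto)
  then have "g y = y"
    using lim LIMSEQ_unique by (fastforce simp: o_def)
  with y K show thesis using that by blast
qed

section \<open>Subgradients and fixed points of the gradient\<close>

text \<open>The deterministic part of the hypotheses, separated so that the fixed-point problem can
  be solved without reference to the random vectors.\<close>

locale dual_setting =
  fixes E0 :: "'e::banach set"
    and F :: "('e \<Rightarrow> real) set"
    and Phi :: "'e \<Rightarrow> ('e \<Rightarrow> real) \<Rightarrow> real"
  assumes E0_subspace: "subspace E0"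
    and E0_closed: "closed E0"
    and F_zero: "(\<lambda>y. 0) \<in> F"
    and F_add: "\<And>\<xi> \<eta>. \<xi> \<in> F \<Longrightarrow> \<eta> \<in> F \<Longrightarrow> (\<lambda>y. \<xi> y + \<eta> y) \<in> F"
    and F_scale: "\<And>\<xi> c. \<xi> \<in> F \<Longrightarrow> (\<lambda>y. c * \<xi> y) \<in> F"
    and F_linear: "\<And>\<xi>. \<xi> \<in> F \<Longrightarrow> linear \<xi>"
    and F_surj: "\<And>f. (\<forall>x\<in>E0. \<forall>y\<in>E0. f (x + y) = f x + f y) \<Longrightarrow>
                     (\<forall>c. \<forall>x\<in>E0. f (c *\<^sub>R x) = c * f x) \<Longrightarrow> continuous_on E0 f \<Longrightarrow>
                     \<exists>\<xi>\<in>F. \<forall>x\<in>E0. \<xi> x = f x"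
    and F_meas: "\<And>\<xi>. \<xi> \<in> F \<Longrightarrow> \<xi> \<in> borel_measurable ball_sigma"
    and A2_cont: "\<And>\<xi>. \<xi> \<in> F \<Longrightarrow> continuous_on UNIV (\<lambda>x. Phi x \<xi>)"
    and A2_zero: "\<And>x. Phi x (\<lambda>y. 0) = 0"
    and A7: "\<And>x. phistar F Phi x x < \<infinity> \<Longrightarrow>
               \<exists>U. open U \<and> x \<in> U \<and>
                 (\<forall>l\<ge>0. (\<Union>y\<in>U. {z. phistar F Phi y z \<le> ereal l}) \<subseteq> E0 \<and>
                         compact (closure (\<Union>y\<in>U. {z. phistar F Phi y z \<le> ereal l})))"
    and A8: "\<And>xs x \<xi>s \<xi>. (\<forall>n. xs n \<in> E0) \<Longrightarrow> x \<in> E0 \<Longrightarrow> xs \<longlonglongrightarrow> x \<Longrightarrow>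
               (\<forall>n. \<xi>s n \<in> F) \<Longrightarrow> \<xi> \<in> F \<Longrightarrow> (\<forall>z\<in>E0. (\<lambda>n. \<xi>s n z) \<longlonglongrightarrow> \<xi> z) \<Longrightarrow>
               ereal (Phi x \<xi>) \<le> liminf (\<lambda>n. ereal (Phi (xs n) (\<xi>s n)))"
    and A9_convex: "\<And>x \<xi> \<eta> t. \<xi> \<in> F \<Longrightarrow> \<eta> \<in> F \<Longrightarrow> 0 \<le> t \<Longrightarrow> t \<le> 1 \<Longrightarrow>
               Phi x (\<lambda>y. (1 - t) * \<xi> y + t * \<eta> y) \<le> (1 - t) * Phi x \<xi> + t * Phi x \<eta>"
    and A9_diff: "\<And>x \<xi>. \<xi> \<in> F \<Longrightarrow> gateaux_differentiable F E0 (Phi x) \<xi>"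
begin

abbreviation grad :: "'e \<Rightarrow> ('e \<Rightarrow> real) \<Rightarrow> 'e" where
  "grad x \<equiv> gateaux_grad F E0 (Phi x)"

lemma F_bounded_linear: "\<xi> \<in> F \<Longrightarrow> bounded_linear \<xi>"
  using linear_measurable_imp_bounded_linear F_linear F_meas by blast

lemma F_continuous: "\<xi> \<in> F \<Longrightarrow> continuous_on S \<xi>"
  using F_bounded_linear linear_continuous_on by blast

lemma F_continuous_Phi: "\<xi> \<in> F \<Longrightarrow> continuous_on S (\<lambda>x. Phi x \<xi>)"
  using A2_cont continuous_on_subset by blast

text \<open>A bounded functional on \<open>E\<close> that separates the points restricts to
  \<open>E0\<close>, and \<open>F_surj\<close> finds a member of \<open>F\<close> with the same
  restriction.\<close>

lemma F_separates:
  assumes "x \<in> E0" "y \<in> E0" "\<And>\<eta>. \<eta> \<in> F \<Longrightarrow> \<eta> x = \<eta> y"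
  shows "x = y"
proof (rule ccontr)
  assume "x \<noteq> y"
  then obtain f :: "'e \<Rightarrow> real" where f: "bounded_linear f" "f (x - y) \<noteq> 0"
    using exists_bounded_linear_nonzero[of "x - y"] by auto
  then have lin: "linear f"
    by (simp add: bounded_linear.linear)
  have "\<exists>\<xi>\<in>F. \<forall>x\<in>E0. \<xi> x = f x"
    by (rule F_surj) (auto simp: linear_add[OF lin] linear_scale[OF lin] f linear_continuous_on)
  then obtain \<xi> where "\<xi> \<in> F" "\<forall>x\<in>E0. \<xi> x = f x" ..
  then have "f x = f y"
    using assms by metis
  then show False
    using f(2) by (simp add: linear_diff[OF lin])
qed

lemma phistar_ge: "\<xi> \<in> F \<Longrightarrow> ereal (\<xi> y - Phi x \<xi>) \<le> phistar F Phi x y"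
  unfolding phistar_def by (rule SUP_upper)

lemma phistar_le_iff: "phistar F Phi x y \<le> ereal l \<longleftrightarrow> (\<forall>\<xi>\<in>F. \<xi> y - Phi x \<xi> \<le> l)"
  unfolding phistar_def by (simp add: SUP_le_iff)

lemma phistar_nonneg: "0 \<le> phistar F Phi x y"
  using phistar_ge[OF F_zero, where x = x and y = y] by (simp add: A2_zero zero_ereal_def)

text \<open>\<open>A7\<close> puts the level sets of \<open>phistar F Phi x\<close> inside
  \<open>E0\<close>, and \<open>x\<close> lies in one of them.\<close>

lemma phistar_finite_imp_E0:
  assumes "phistar F Phi x x < \<infinity>"
  shows "x \<in> E0"
proof -
  obtain l where l: "phistar F Phi x x = ereal l" "l \<ge> 0"
    using assms phistar_nonneg[of x x] by (cases "phistar F Phi x x") auto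
  then show ?thesis
    using A7[OF assms] by force
qed

lemma closed_phistar_diagonal_le: "closed {x. phistar F Phi x x \<le> ereal l}"
proof -
  have "{x. phistar F Phi x x \<le> ereal l} = (\<Inter>\<xi>\<in>F. {x. \<xi> x - Phi x \<xi> \<le> l})"
    by (auto simp: phistar_le_iff)
  also have "closed \<dots>"
    by (intro closed_INT ballI closed_Collect_le continuous_intros F_continuous F_continuous_Phi)
  finally show ?thesis .
qed

section \<open>Gradients as unique subgradients\<close>

lemma gateaux_has_grad_grad: "\<xi> \<in> F \<Longrightarrow> gateaux_has_grad F E0 (Phi x) \<xi> (grad x \<xi>)"
  using A9_diff unfolding gateaux_differentiable_def gateaux_grad_def by (rule someI_ex)

lemma grad_in_E0: "\<xi> \<in> F \<Longrightarrow> grad x \<xi> \<in> E0"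
  using gateaux_has_grad_grad by (auto simp: gateaux_has_grad_def)

lemma grad_tendsto_at_right:
  assumes "\<xi> \<in> F" "\<eta> \<in> F"
  shows "((\<lambda>t. (Phi x (\<lambda>y. \<xi> y + t * \<eta> y) - Phi x \<xi>) / t) \<longlongrightarrow> \<eta> (grad x \<xi>)) (at_right 0)"
  using gateaux_has_grad_grad[OF assms(1)] assms(2) at_le[of "{0<..}" UNIV]
  unfolding gateaux_has_grad_def by (blast intro: tendsto_mono)

text \<open>By convexity every difference quotient at \<open>0 < t < 1\<close> is at most the one at
  \<open>t = 1\<close>.\<close>

lemma grad_subgradient:
  assumes "\<xi> \<in> F" "\<zeta> \<in> F"
  shows "Phi x \<xi> + (\<zeta> (grad x \<xi>) - \<xi> (grad x \<xi>)) \<le> Phi x \<zeta>"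
proof -
  have "(\<lambda>y. \<zeta> y + (-1) * \<xi> y) \<in> F"
    using assms F_add F_scale by blast
  then have \<eta>: "(\<lambda>y. \<zeta> y - \<xi> y) \<in> F" by simp
  have "\<zeta> (grad x \<xi>) - \<xi> (grad x \<xi>) \<le> Phi x \<zeta> - Phi x \<xi>"
  proof (rule tendsto_upperbound[OF grad_tendsto_at_right[OF assms(1) \<eta>]])
    have "(Phi x (\<lambda>y. \<xi> y + t * (\<zeta> y - \<xi> y)) - Phi x \<xi>) / t \<le> Phi x \<zeta> - Phi x \<xi>"
      if "0 < t" "t < 1" for t
    proof -
      have "(\<lambda>y. \<xi> y + t * (\<zeta> y - \<xi> y)) = (\<lambda>y. (1 - t) * \<xi> y + t * \<zeta> y)"
        by (auto simp: algebra_simps)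
      then have "Phi x (\<lambda>y. \<xi> y + t * (\<zeta> y - \<xi> y)) \<le> (1 - t) * Phi x \<xi> + t * Phi x \<zeta>"
        using A9_convex[OF assms, of t x] that by simp
      moreover have "p \<le> (1 - t) * a + t * b \<Longrightarrow> p - a \<le> (b - a) * t" for p a b :: real
        by (simp add: algebra_simps)
      ultimately have "Phi x (\<lambda>y. \<xi> y + t * (\<zeta> y - \<xi> y)) - Phi x \<xi> \<le> (Phi x \<zeta> - Phi x \<xi>) * t"
        by blast
      then show ?thesis
        using that by (simp add: pos_divide_le_eq)
    qed
    then show "\<forall>\<^sub>F t in at_right 0.
        (Phi x (\<lambda>y. \<xi> y + t * (\<zeta> y - \<xi> y)) - Phi x \<xi>) / t \<le> Phi x \<zeta> - Phi x \<xi>"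
      by (intro eventually_at_rightI[of 0 1]) auto
  qed simp
  then show ?thesis by simp
qed

text \<open>The slack \<open>c * t\<^sup>2\<close> vanishes in the difference quotient; it leaves
  room for the quadratic penalty in the first-order conditions.\<close>

lemma le_grad:
  assumes "\<xi> \<in> F" "\<eta> \<in> F"
    and "\<And>t. t > 0 \<Longrightarrow> Phi x \<xi> + t * b - c * t\<^sup>2 \<le> Phi x (\<lambda>y. \<xi> y + t * \<eta> y)"
  shows "b \<le> \<eta> (grad x \<xi>)"
proof (rule tendsto_le[OF _ grad_tendsto_at_right[OF assms(1,2)]])
  have "((\<lambda>t. b - c * t) \<longlongrightarrow> b - c * 0) (at_right 0)"
    by (intro tendsto_intros)
  then show "((\<lambda>t. b - c * t) \<longlongrightarrow> b) (at_right 0)" by simp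
  have "b - c * t \<le> (Phi x (\<lambda>y. \<xi> y + t * \<eta> y) - Phi x \<xi>) / t" if "0 < t" for t
    using assms(3)[OF that] that by (simp add: le_divide_eq algebra_simps power2_eq_square)
  then show "\<forall>\<^sub>F t in at_right 0. b - c * t \<le> (Phi x (\<lambda>y. \<xi> y + t * \<eta> y) - Phi x \<xi>) / t"
    by (intro eventually_at_rightI[of 0 1]) auto
qed simp

lemma grad_eqI:
  assumes "\<xi> \<in> F" "\<eta> \<in> F"
    and le: "\<And>t. Phi x \<xi> + t * b - c * t\<^sup>2 \<le> Phi x (\<lambda>y. \<xi> y + t * \<eta> y)"
  shows "\<eta> (grad x \<xi>) = b"
proof (rule antisym)
  have "(\<lambda>y. (- 1) * \<eta> y) \<in> F" using assms F_scale by blast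
  then have "(\<lambda>y. - \<eta> y) \<in> F" by simp
  moreover have "Phi x \<xi> + t * (- b) - c * t\<^sup>2 \<le> Phi x (\<lambda>y. \<xi> y + t * - \<eta> y)" for t
    using le[of "- t"] by simp
  ultimately have "- b \<le> - \<eta> (grad x \<xi>)"
    using le_grad[OF assms(1)] by blast
  then show "\<eta> (grad x \<xi>) \<le> b" by simp
  show "b \<le> \<eta> (grad x \<xi>)"
    by (rule le_grad[OF assms(1,2) le])
qed

text \<open>A subgradient at a point of differentiability has the same pairing as the gradient with
  every direction, and \<open>F\<close> separates \<open>E0\<close>.\<close>

lemma grad_unique:
  assumes "\<xi> \<in> F" "z \<in> E0" and le: "\<And>\<zeta>. \<zeta> \<in> F \<Longrightarrow> Phi x \<xi> + (\<zeta> z - \<xi> z) \<le> Phi x \<zeta>"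
  shows "grad x \<xi> = z"
proof (rule F_separates)
  fix \<eta> assume \<eta>: "\<eta> \<in> F"
  show "\<eta> (grad x \<xi>) = \<eta> z"
  proof (rule grad_eqI[OF assms(1) \<eta>])
    fix t
    have "(\<lambda>y. \<xi> y + t * \<eta> y) \<in> F" using assms \<eta> F_add F_scale by blast
    from le[OF this] show "Phi x \<xi> + t * \<eta> z - 0 * t\<^sup>2 \<le> Phi x (\<lambda>y. \<xi> y + t * \<eta> y)"
      by simp
  qed
qed (use assms grad_in_E0 in auto)

text \<open>The form in which \<open>A8\<close> is used: upper bounds on \<open>Phi\<close> survive
  joint limits.\<close>

lemma Phi_le_limit:
  assumes "\<And>n. xs n \<in> E0" "x \<in> E0" "xs \<longlonglongrightarrow> x" "\<And>n. \<xi>s n \<in> F" "\<xi> \<in> F"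
    and "\<And>z. z \<in> E0 \<Longrightarrow> (\<lambda>n. \<xi>s n z) \<longlonglongrightarrow> \<xi> z"
    and "\<And>n. Phi (xs n) (\<xi>s n) \<le> u n" "u \<longlonglongrightarrow> v"
  shows "Phi x \<xi> \<le> v"
proof -
  have "ereal (Phi x \<xi>) \<le> liminf (\<lambda>n. ereal (Phi (xs n) (\<xi>s n)))"
    using assms by (intro A8) auto
  also have "\<dots> \<le> liminf (\<lambda>n. ereal (u n))"
    using assms by (intro Liminf_mono) auto
  also have "\<dots> = ereal v"
    using assms by (intro lim_imp_Liminf) auto
  finally show ?thesis by simp
qed

end

text \<open>Closed graph and compact range: a subsequence staying away from \<open>f x\<close> would
  have a convergent further subsequence, whose limit the graph condition identifies as
  \<open>f x\<close>.\<close>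

lemma continuous_on_closed_graphI:
  fixes f :: "'a::metric_space \<Rightarrow> 'b::metric_space"
  assumes T: "compact T" "f ` S \<subseteq> T"
    and graph: "\<And>xs x y. (\<And>n. xs n \<in> S) \<Longrightarrow> x \<in> S \<Longrightarrow> xs \<longlonglongrightarrow> x \<Longrightarrow> (\<lambda>n. f (xs n)) \<longlonglongrightarrow> y \<Longrightarrow> y = f x"
  shows "continuous_on S f"
  unfolding continuous_on_sequentially
proof (intro allI ballI impI)
  fix xs x assume x: "x \<in> S" and "(\<forall>n. xs n \<in> S) \<and> xs \<longlonglongrightarrow> x"
  then have xs: "\<And>n. xs n \<in> S" "xs \<longlonglongrightarrow> x" by auto
  show "(f \<circ> xs) \<longlonglongrightarrow> f x"
  proof (rule ccontr)
    assume "\<not> (f \<circ> xs) \<longlonglongrightarrow> f x"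
    then obtain e where e: "e > 0" "\<forall>N. \<exists>n\<ge>N. dist (f (xs n)) (f x) \<ge> e"
      unfolding lim_sequentially by (auto simp: not_less)
    then have "infinite {n. dist (f (xs n)) (f x) \<ge> e}"
      unfolding infinite_nat_iff_unbounded_le by auto
    then obtain \<phi> :: "nat \<Rightarrow> nat" where \<phi>: "strict_mono \<phi>" "\<And>n. dist (f (xs (\<phi> n))) (f x) \<ge> e"
      using infinite_enumerate by blast
    have "\<forall>n. f (xs (\<phi> n)) \<in> T" using xs T(2) by auto
    then obtain y \<psi> where \<psi>: "strict_mono \<psi>" and y: "((\<lambda>n. f (xs (\<phi> n))) \<circ> \<psi>) \<longlonglongrightarrow> y"
      by (rule seq_compactE[OF compact_imp_seq_compact[OF T(1)]])
    have "(xs \<circ> (\<phi> \<circ> \<psi>)) \<longlonglongrightarrow> x"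
      using \<phi> \<psi> xs(2) by (intro LIMSEQ_subseq_LIMSEQ strict_mono_o)
    then have "y = f x"
      using xs x y by (intro graph[of "\<lambda>n. xs (\<phi> (\<psi> n))"]) (auto simp: o_def)
    then have "(\<lambda>n. dist (f (xs (\<phi> (\<psi> n)))) (f x)) \<longlonglongrightarrow> dist (f x) (f x)"
      using y by (intro tendsto_intros) (simp add: o_def)
    then have "(\<lambda>n. dist (f (xs (\<phi> (\<psi> n)))) (f x)) \<longlonglongrightarrow> 0" by simp
    then have "e \<le> 0"
      using \<phi>(2) by (intro LIMSEQ_le_const) auto
    with e show False by simp
  qed
qed

text \<open>On a compact set weak closeness is norm closeness: the part of \<open>K\<close> outside
  the ball is covered by finitely many open sets on each of which one functional tells
  \<open>z\<close> from \<open>y\<close>.\<close>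

lemma (in dual_setting) finite_weak_neighbourhood:
  assumes K: "compact K" "K \<subseteq> E0" and y: "y \<in> E0" and r: "r > 0"
  obtains \<eta> :: "nat \<Rightarrow> 'e \<Rightarrow> real" and m \<tau> where "\<And>j. j < m \<Longrightarrow> \<eta> j \<in> F" "\<tau> > 0"
    "\<And>z. z \<in> K \<Longrightarrow> (\<And>j. j < m \<Longrightarrow> \<bar>\<eta> j z - \<eta> j y\<bar> \<le> \<tau>) \<Longrightarrow> dist z y < r"
proof -
  let ?V = "\<lambda>(\<eta>, \<tau>). {w. \<bar>\<eta> w - \<eta> y\<bar> > (\<tau>::real)}"
  let ?S = "K - ball y r"
  have "compact ?S" using K by (intro compact_diff) auto
  moreover have "open (?V p)" if "p \<in> F \<times> {0<..}" for p
  proof -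
    have "continuous_on UNIV (fst p)"
      using that by (intro F_continuous) auto
    then have "open {w. snd p < \<bar>fst p w - fst p y\<bar>}"
      by (intro open_Collect_less continuous_intros)
    then show ?thesis by (simp add: case_prod_beta)
  qed
  moreover have "?S \<subseteq> (\<Union>p\<in>F \<times> {0<..}. ?V p)"
  proof
    fix z assume z: "z \<in> ?S"
    then have "z \<noteq> y" using r by auto
    then obtain \<eta> where "\<eta> \<in> F" "\<eta> z \<noteq> \<eta> y"
      using F_separates[of z y] z K y by auto
    then show "z \<in> (\<Union>p\<in>F \<times> {0<..}. ?V p)"
      by (intro UN_I[of "(\<eta>, \<bar>\<eta> z - \<eta> y\<bar> / 2)"]) auto
  qed
  ultimately obtain C where C: "C \<subseteq> F \<times> {0<..}" "finite C" "?S \<subseteq> (\<Union>p\<in>C. ?V p)"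
    by (rule compactE_image)
  obtain p :: "nat \<Rightarrow> ('e \<Rightarrow> real) \<times> real" and m where p: "C = p ` {i. i < m}"
    using finite_imp_nat_seg_image_inj_on[OF C(2)] by metis
  have pj: "p j \<in> F \<times> {0<..}" if "j < m" for j
    using C(1) that unfolding p by blast
  \<comment> \<open>The inserted 1 keeps the minimum defined when the cover is empty.\<close>
  define \<tau> where "\<tau> = Min (insert 1 (snd ` C))"
  show thesis
  proof (rule that[of m "\<lambda>j. fst (p j)" \<tau>])
    show "fst (p j) \<in> F" if "j < m" for j
      using pj[OF that] by (simp add: mem_Times_iff)
    have "snd q > 0" if "q \<in> C" for q
      using that C(1) by (auto simp: mem_Times_iff)
    then show "\<tau> > 0"
      using C(2) by (simp add: \<tau>_def)
    fix z assume z: "z \<in> K" and le: "\<And>j. j < m \<Longrightarrow> \<bar>fst (p j) z - fst (p j) y\<bar> \<le> \<tau>"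
    show "dist z y < r"
    proof (rule ccontr)
      assume "\<not> dist z y < r"
      then obtain j where j: "j < m" "z \<in> ?V (p j)"
        using z C(3) unfolding p by (auto simp: dist_commute)
      then have "\<bar>fst (p j) z - fst (p j) y\<bar> > snd (p j)"
        by (auto simp: case_prod_beta)
      moreover have "\<tau> \<le> snd (p j)"
        unfolding \<tau>_def using j C(2) p by (intro Min_le) auto
      ultimately show False using le[OF j(1)] by simp
    qed
  qed
qed

text \<open>Restricting to finitely many directions makes the maximiser of the regularised objective exist;
  the quadratic term makes it unique, hence continuous in \<open>x\<close>.\<close>

locale galerkin = dual_setting E0 F Phi
  for E0 :: "'e::banach set" and F Phi +
  fixes \<eta> :: "nat \<Rightarrow> 'e \<Rightarrow> real" and m :: nat and y0 :: 'e and \<delta> l :: real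
  assumes \<eta>_in_F: "\<And>j. j < m \<Longrightarrow> \<eta> j \<in> F" and \<delta>_pos: "\<delta> > 0" and l_nonneg: "l \<ge> 0"
begin

definition comb :: "(nat \<Rightarrow> real) \<Rightarrow> 'e \<Rightarrow> real" where
  "comb c = (\<lambda>y. \<Sum>j<m. c j * \<eta> j y)"

text \<open>The zero tail makes the finite-dimensional coefficient space a set of functions in which
  a maximiser is unique as a function.\<close>

definition coeffs :: "(nat \<Rightarrow> real) set" where
  "coeffs = {c. \<forall>j\<ge>m. c j = 0}"

definition obj :: "'e \<Rightarrow> (nat \<Rightarrow> real) \<Rightarrow> real" where
  "obj x c = comb c y0 - Phi x (comb c) - \<delta> / 2 * (\<Sum>j<m. (c j)\<^sup>2)"

text \<open>The competitor 0 has objective 0, so only nonnegative values matter. For these the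
  penalty \<open>\<delta> / 2\<close> times the sum of squares is at most \<open>l\<close>, which
  gives the radius.\<close>

definition coeff_box :: "(nat \<Rightarrow> real) set" where
  "coeff_box = {c \<in> coeffs. \<forall>j<m. \<bar>c j\<bar> \<le> sqrt (2 * l / \<delta>)}"

lemma comb_in_F: "comb c \<in> F"
proof -
  have "(\<lambda>y. \<Sum>j<k. c j * \<eta> j y) \<in> F" if "k \<le> m" for k
    using that
  proof (induction k)
    case (Suc k)
    then have "(\<lambda>y. c k * \<eta> k y) \<in> F"
      by (intro F_scale \<eta>_in_F) auto
    then show ?case
      using F_add Suc by simp
  qed (simp add: F_zero)
  then show ?thesis
    by (simp add: comb_def)
qed

lemma compact_coeff_box: "compact coeff_box"
proof -
  let ?R = "sqrt (2 * l / \<delta>)"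
  have "coeff_box = Pi\<^sub>E UNIV (\<lambda>j. if j < m then {-?R..?R} else {0})"
    by (auto simp: coeff_box_def coeffs_def PiE_iff abs_le_iff minus_le_iff split: if_splits)
  then show ?thesis
    by (auto intro: compact_PiE_UNIV)
qed

lemma zero_in_coeffs: "(\<lambda>_. 0) \<in> coeffs"
  by (simp add: coeffs_def)

lemma obj_zero: "obj x (\<lambda>_. 0) = 0"
  by (simp add: obj_def comb_def A2_zero)

lemma obj_le:
  assumes "phistar F Phi x y0 \<le> ereal l"
  shows "obj x c + \<delta> / 2 * (\<Sum>j<m. (c j)\<^sup>2) \<le> l"
  using assms comb_in_F[of c] by (auto simp: phistar_le_iff obj_def)

lemma sum_squares_le:
  assumes "phistar F Phi x y0 \<le> ereal l" "obj x c \<ge> 0"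
  shows "(\<Sum>j<m. (c j)\<^sup>2) \<le> 2 * l / \<delta>"
  using obj_le[OF assms(1), of c] assms(2) \<delta>_pos by (simp add: field_simps)

lemma in_coeff_box:
  assumes "phistar F Phi x y0 \<le> ereal l" "obj x c \<ge> 0" "c \<in> coeffs"
  shows "c \<in> coeff_box"
proof -
  have "\<bar>c j\<bar> \<le> sqrt (2 * l / \<delta>)" if "j < m" for j
  proof (rule real_le_rsqrt)
    have "(c j)\<^sup>2 \<le> (\<Sum>j<m. (c j)\<^sup>2)"
      using that by (intro member_le_sum) auto
    then show "\<bar>c j\<bar>\<^sup>2 \<le> 2 * l / \<delta>"
      using sum_squares_le[OF assms(1,2)] by simp
  qed
  with assms(3) show ?thesis by (simp add: coeff_box_def)
qed

lemma comb_tendsto: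
  assumes "cs \<longlonglongrightarrow> c" "\<And>\<xi>. \<xi> \<in> F \<Longrightarrow> (\<lambda>n. \<xi> (zs n)) \<longlonglongrightarrow> \<xi> z"
  shows "(\<lambda>n. comb (cs n) (zs n)) \<longlonglongrightarrow> comb c z"
  unfolding comb_def
  using assms \<eta>_in_F by (intro tendsto_sum tendsto_mult tendsto_fun_component[OF assms(1)]) auto

text \<open>Joint upper semicontinuity of the objective. With constant \<open>xs\<close> it gives
  existence of a maximiser, with varying \<open>xs\<close> continuity of the maximiser.\<close>

lemma obj_limit:
  assumes x: "\<And>n. xs n \<in> E0" "x \<in> E0" "xs \<longlonglongrightarrow> x" and c: "cs \<longlonglongrightarrow> c"
    and b: "\<And>n. b n \<le> obj (xs n) (cs n)" "b \<longlonglongrightarrow> B"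
  shows "B \<le> obj x c"
proof -
  have "Phi x (comb c) \<le> comb c y0 - \<delta> / 2 * (\<Sum>j<m. (c j)\<^sup>2) - B"
  proof (rule Phi_le_limit[OF x comb_in_F comb_in_F])
    show "(\<lambda>n. comb (cs n) z) \<longlonglongrightarrow> comb c z" for z
      by (rule comb_tendsto[OF c]) simp
    then show "(\<lambda>n. comb (cs n) y0 - \<delta> / 2 * (\<Sum>j<m. (cs n j)\<^sup>2) - b n)
        \<longlonglongrightarrow> comb c y0 - \<delta> / 2 * (\<Sum>j<m. (c j)\<^sup>2) - B"
      by (intro tendsto_intros b(2) tendsto_fun_component[OF c])
    show "Phi (xs n) (comb (cs n)) \<le> comb (cs n) y0 - \<delta> / 2 * (\<Sum>j<m. (cs n j)\<^sup>2) - b n" for n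
      using b(1)[of n] by (simp add: obj_def)
  qed
  then show ?thesis by (simp add: obj_def)
qed

section \<open>Existence and uniqueness of the regularised maximiser\<close>

definition maximizer :: "'e \<Rightarrow> (nat \<Rightarrow> real) \<Rightarrow> bool" where
  "maximizer x c \<longleftrightarrow> c \<in> coeffs \<and> (\<forall>d\<in>coeffs. obj x d \<le> obj x c)"

lemma exists_maximizer:
  assumes x: "x \<in> E0" and l: "phistar F Phi x y0 \<le> ereal l"
  shows "\<exists>c. maximizer x c"
proof -
  define S where "S = (SUP c\<in>coeff_box. obj x c)"
  have zb: "(\<lambda>_. 0) \<in> coeff_box"
    using in_coeff_box[OF l] obj_zero zero_in_coeffs by simp
  have "obj x c \<le> l" for c
    using obj_le[OF l, of c] \<delta>_pos sum_nonneg[of "{..<m}" "\<lambda>j. (c j)\<^sup>2"]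
    by (smt (verit) divide_nonneg_nonneg mult_nonneg_nonneg zero_le_power2)
  then have bdd: "bdd_above (obj x ` coeff_box)"
    by (intro bdd_aboveI2[where M = l])
  have "\<exists>c\<in>coeff_box. S - inverse (real (Suc n)) < obj x c" for n
    using less_cSUP_iff[OF _ bdd, of "S - inverse (real (Suc n))"] zb unfolding S_def by auto
  then obtain cs where cs: "\<forall>n. cs n \<in> coeff_box" "\<And>n. S - inverse (real (Suc n)) < obj x (cs n)"
    by metis
  obtain c \<phi> where c: "c \<in> coeff_box" "strict_mono \<phi>" "(cs \<circ> \<phi>) \<longlonglongrightarrow> c"
    using seq_compactE[OF compact_imp_seq_compact[OF compact_coeff_box] cs(1)] by blast
  have "S \<le> obj x c"
  proof (rule obj_limit[where xs = "\<lambda>_. x" and cs = "cs \<circ> \<phi>"])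
    show "S - inverse (real (Suc (\<phi> n))) \<le> obj x ((cs \<circ> \<phi>) n)" for n
      using cs(2)[of "\<phi> n"] by simp
    have "(\<lambda>n. inverse (real (Suc (\<phi> n)))) \<longlonglongrightarrow> 0"
      using LIMSEQ_subseq_LIMSEQ[OF LIMSEQ_inverse_real_of_nat c(2)] by (simp add: o_def)
    from tendsto_diff[OF tendsto_const this]
    show "(\<lambda>n. S - inverse (real (Suc (\<phi> n)))) \<longlonglongrightarrow> S" by simp
  qed (use x c in auto)
  have max: "obj x d \<le> S" if "d \<in> coeffs" for d
  proof (cases "obj x d \<ge> 0")
    case True
    then show ?thesis
      unfolding S_def using that l by (intro cSUP_upper bdd in_coeff_box)
  next
    case False
    have "obj x (\<lambda>_. 0) \<le> S"
      unfolding S_def by (intro cSUP_upper bdd zb)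
    then show ?thesis using False obj_zero by simp
  qed
  have "obj x d \<le> obj x c" if "d \<in> coeffs" for d
    using order_trans[OF max[OF that] \<open>S \<le> obj x c\<close>] .
  then show ?thesis
    using c(1) unfolding maximizer_def coeff_box_def by blast
qed

text \<open>At the midpoint of two maximisers convexity of \<open>Phi x\<close> loses nothing, and
  the parallelogram identity for the penalty gains \<open>\<delta> / 8\<close> times the squared
  distance.\<close>

lemma maximizer_unique:
  assumes "maximizer x c" "maximizer x d"
  shows "c = d"
proof -
  define e where "e j = (c j + d j) / 2" for j
  have e: "e \<in> coeffs"
    using assms by (auto simp: maximizer_def coeffs_def e_def)
  have comb_e: "comb e = (\<lambda>y. (1 - 1/2) * comb c y + 1/2 * comb d y)"
    by (auto simp: comb_def e_def sum_distrib_left sum.distrib[symmetric] field_simps intro!: sum.cong)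
  have "Phi x (comb e) \<le> (1 - 1/2) * Phi x (comb c) + 1/2 * Phi x (comb d)"
    unfolding comb_e by (rule A9_convex) (auto intro: comb_in_F)
  then have Phi_e: "Phi x (comb e) \<le> 1/2 * Phi x (comb c) + 1/2 * Phi x (comb d)"
    by simp
  have "(\<Sum>j<m. (e j)\<^sup>2) =
      1/2 * (\<Sum>j<m. (c j)\<^sup>2) + 1/2 * (\<Sum>j<m. (d j)\<^sup>2) - 1/4 * (\<Sum>j<m. (c j - d j)\<^sup>2)"
    unfolding sum_distrib_left sum.distrib[symmetric] sum_subtractf[symmetric]
    by (rule sum.cong) (auto simp: e_def power2_eq_square field_simps)
  then have sq_e: "\<delta> / 2 * (\<Sum>j<m. (e j)\<^sup>2) = 1/2 * (\<delta> / 2 * (\<Sum>j<m. (c j)\<^sup>2))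
      + 1/2 * (\<delta> / 2 * (\<Sum>j<m. (d j)\<^sup>2)) - \<delta> / 8 * (\<Sum>j<m. (c j - d j)\<^sup>2)"
    by (simp only:) (simp add: algebra_simps)
  have "1/2 * (yc - pc - sc) + 1/2 * (yd - pd - sd) + q \<le> ye - pe - se"
    if "pe \<le> 1/2 * pc + 1/2 * pd" "se = 1/2 * sc + 1/2 * sd - q" "ye = (1 - 1/2) * yc + 1/2 * yd"
    for yc pc sc yd pd sd q ye pe se :: real
    using that by (simp add: field_simps)
  from this[OF Phi_e sq_e fun_cong[OF comb_e]]
  have "obj x e \<ge> 1/2 * obj x c + 1/2 * obj x d + \<delta> / 8 * (\<Sum>j<m. (c j - d j)\<^sup>2)"
    unfolding obj_def .
  moreover have "obj x c = obj x d"
    using assms by (auto simp: maximizer_def intro: antisym)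
  moreover have "obj x e \<le> obj x c"
    using assms e by (auto simp: maximizer_def)
  ultimately have "\<delta> / 8 * (\<Sum>j<m. (c j - d j)\<^sup>2) \<le> 0"
    by linarith
  then have "(\<Sum>j<m. (c j - d j)\<^sup>2) \<le> 0"
    using \<delta>_pos by (simp add: mult_le_0_iff)
  then have "(\<Sum>j<m. (c j - d j)\<^sup>2) = 0"
    by (intro antisym sum_nonneg) auto
  then have "\<forall>j<m. c j = d j"
    by (simp add: sum_nonneg_eq_0_iff)
  moreover have "\<forall>j\<ge>m. c j = d j"
    using assms by (simp add: maximizer_def coeffs_def)
  ultimately show ?thesis
    by (intro ext) (meson leI)
qed

section \<open>The fixed-point map and its continuity\<close>

definition opt :: "'e \<Rightarrow> nat \<Rightarrow> real" where
  "opt x = (SOME c. maximizer x c)"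

definition step :: "'e \<Rightarrow> 'e" where
  "step x = grad x (comb (opt x))"

context
  fixes x
  assumes x: "x \<in> E0" and l: "phistar F Phi x y0 \<le> ereal l"
begin

lemma maximizer_opt: "maximizer x (opt x)"
  unfolding opt_def using exists_maximizer[OF x l] by (rule someI_ex)

lemma obj_opt_nonneg: "obj x (opt x) \<ge> 0"
  using maximizer_opt zero_in_coeffs obj_zero[of x] unfolding maximizer_def by metis

lemma opt_in_coeff_box: "opt x \<in> coeff_box"
  using in_coeff_box[OF l obj_opt_nonneg] maximizer_opt by (simp add: maximizer_def)

text \<open>The first-order condition for the maximiser when its \<open>j\<close>-th coefficient
  varies.\<close>

lemma step_component:
  assumes j: "j < m"
  shows "\<eta> j (step x) = \<eta> j y0 - \<delta> * opt x j"
  unfolding step_def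
proof (rule grad_eqI[OF comb_in_F \<eta>_in_F[OF j]])
  fix t :: real
  let ?c = "opt x"
  let ?d = "?c(j := ?c j + t)"
  have split: "(\<Sum>i<m. f (?d i) i) = (\<Sum>i<m. f (?c i) i) + (f (?c j + t) j - f (?c j) j)"
    for f :: "real \<Rightarrow> nat \<Rightarrow> real"
    using j by (simp add: sum.remove[of "{..<m}" j])
  have comb_d: "comb ?d = (\<lambda>y. comb ?c y + t * \<eta> j y)"
    using split[of "\<lambda>a i. a * \<eta> i _"] by (auto simp: comb_def algebra_simps)
  have "?d \<in> coeffs"
    using maximizer_opt j by (auto simp: maximizer_def coeffs_def)
  then have "obj x ?d \<le> obj x ?c"
    using maximizer_opt by (simp add: maximizer_def)
  moreover have "obj x ?d = (comb ?c y0 + t * \<eta> j y0) - Phi x (\<lambda>y. comb ?c y + t * \<eta> j y)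
      - \<delta> / 2 * ((\<Sum>i<m. (?c i)\<^sup>2) + ((?c j + t)\<^sup>2 - (?c j)\<^sup>2))"
    unfolding obj_def comb_d split[of "\<lambda>a i. a\<^sup>2"] ..
  moreover have "\<delta> / 2 * (S + ((u + t)\<^sup>2 - u\<^sup>2)) = \<delta> / 2 * S + t * (\<delta> * u) + \<delta> / 2 * t\<^sup>2" for S u
    by (simp add: power2_eq_square field_simps)
  ultimately have "(comb ?c y0 + t * \<eta> j y0) - Phi x (\<lambda>y. comb ?c y + t * \<eta> j y)
      - (\<delta> / 2 * (\<Sum>i<m. (?c i)\<^sup>2) + t * (\<delta> * ?c j) + \<delta> / 2 * t\<^sup>2)
      \<le> comb ?c y0 - Phi x (comb ?c) - \<delta> / 2 * (\<Sum>i<m. (?c i)\<^sup>2)"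
    unfolding obj_def by metis
  then show "Phi x (comb ?c) + t * (\<eta> j y0 - \<delta> * ?c j) - \<delta> / 2 * t\<^sup>2
      \<le> Phi x (\<lambda>y. comb ?c y + t * \<eta> j y)"
    unfolding right_diff_distrib by linarith
qed

text \<open>The coefficient bound \<open>sqrt (2 * l / \<delta>)\<close> times the factor
  \<open>\<delta>\<close> from the first-order condition tends to 0 with
  \<open>\<delta>\<close>.\<close>

lemma step_close:
  assumes j: "j < m"
  shows "\<bar>\<eta> j (step x) - \<eta> j y0\<bar> \<le> sqrt (2 * l * \<delta>)"
proof (rule real_le_rsqrt)
  have "(opt x j)\<^sup>2 \<le> (\<Sum>j<m. (opt x j)\<^sup>2)"
    using j by (intro member_le_sum) auto
  also have "\<dots> \<le> 2 * l / \<delta>"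
    by (rule sum_squares_le[OF l obj_opt_nonneg])
  finally have "\<delta>\<^sup>2 * (opt x j)\<^sup>2 \<le> \<delta>\<^sup>2 * (2 * l / \<delta>)"
    by (intro mult_left_mono) auto
  also have "\<delta>\<^sup>2 * (2 * l / \<delta>) = 2 * l * \<delta>"
    using \<delta>_pos by (simp add: power2_eq_square)
  finally show "\<bar>\<eta> j (step x) - \<eta> j y0\<bar>\<^sup>2 \<le> 2 * l * \<delta>"
    by (simp add: step_component[OF j] power_mult_distrib)
qed

text \<open>The subgradient inequality says that \<open>comb (opt x)\<close> attains the supremum at
  \<open>step x\<close>. By \<open>step_component\<close> its value there is its value at
  \<open>y0\<close> minus a nonnegative multiple of the sum of squares.\<close>

lemma phistar_step_le: "phistar F Phi x (step x) \<le> ereal l"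
  unfolding phistar_le_iff
proof
  fix \<zeta> assume \<zeta>: "\<zeta> \<in> F"
  have "comb (opt x) (step x) = comb (opt x) y0 - \<delta> * (\<Sum>j<m. (opt x j)\<^sup>2)"
    by (simp add: comb_def step_component sum_distrib_left right_diff_distrib sum_subtractf
        power2_eq_square mult.left_commute)
  moreover have "\<delta> * (\<Sum>j<m. (opt x j)\<^sup>2) \<ge> 0"
    using \<delta>_pos by (intro mult_nonneg_nonneg sum_nonneg) auto
  moreover have "comb (opt x) y0 - Phi x (comb (opt x)) \<le> l"
    using l comb_in_F by (auto simp: phistar_le_iff)
  moreover have "Phi x (comb (opt x)) + (\<zeta> (step x) - comb (opt x) (step x)) \<le> Phi x \<zeta>"
    unfolding step_def by (rule grad_subgradient[OF comb_in_F \<zeta>])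
  ultimately show "\<zeta> (step x) - Phi x \<zeta> \<le> l" by linarith
qed

end

text \<open>A limit of maximisers is a maximiser: upper semicontinuity handles the moving
  coefficients, continuity of \<open>Phi\<close> in its first argument each fixed competitor.
  Uniqueness identifies the limit.\<close>

lemma continuous_on_opt:
  assumes D: "D \<subseteq> E0" "\<And>x. x \<in> D \<Longrightarrow> phistar F Phi x y0 \<le> ereal l"
  shows "continuous_on D opt"
proof (rule continuous_on_closed_graphI[OF compact_coeff_box])
  show "opt ` D \<subseteq> coeff_box" using opt_in_coeff_box D by auto
  fix xs x c assume xs: "\<And>n. xs n \<in> D" and x: "x \<in> D" "xs \<longlonglongrightarrow> x" and c: "(\<lambda>n. opt (xs n)) \<longlonglongrightarrow> c"
  have xl: "maximizer x (opt x)" "\<And>n. maximizer (xs n) (opt (xs n))"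
    using maximizer_opt D x xs by auto
  have "c j = 0" if "j \<ge> m" for j
  proof (rule LIMSEQ_unique[OF tendsto_fun_component[OF c, of j]])
    have "opt (xs n) j = 0" for n
      using xl(2)[of n] that by (simp add: maximizer_def coeffs_def)
    then show "(\<lambda>n. opt (xs n) j) \<longlonglongrightarrow> 0" by simp
  qed
  then have cc: "c \<in> coeffs" by (simp add: coeffs_def)
  have "obj x d \<le> obj x c" if d: "d \<in> coeffs" for d
  proof (rule obj_limit[OF _ _ x(2) c])
    show "obj (xs n) d \<le> obj (xs n) (opt (xs n))" for n
      using xl(2)[of n] d by (simp add: maximizer_def)
    have "(\<lambda>n. Phi (xs n) (comb d)) \<longlonglongrightarrow> Phi x (comb d)"
      by (rule continuous_on_tendsto_compose[OF F_continuous_Phi[OF comb_in_F, where S = UNIV] x(2)]) auto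
    then show "(\<lambda>n. obj (xs n) d) \<longlonglongrightarrow> obj x d"
      unfolding obj_def by (intro tendsto_intros)
  qed (use xs x D in auto)
  with cc have "maximizer x c" by (simp add: maximizer_def)
  then show "c = opt x" using maximizer_unique xl(1) by blast
qed

text \<open>No joint continuity of the gradient is assumed. The subgradient inequality passes to the
  limit instead, and \<open>grad_unique\<close> identifies the limit.\<close>

lemma continuous_on_step:
  assumes D: "D \<subseteq> E0" "\<And>x. x \<in> D \<Longrightarrow> phistar F Phi x y0 \<le> ereal l"
    and K: "compact K" "K \<subseteq> E0" "step ` D \<subseteq> K"
  shows "continuous_on D step"
proof (rule continuous_on_closed_graphI[OF K(1,3)])
  fix xs x z assume xs: "\<And>n. xs n \<in> D" and x: "x \<in> D" "xs \<longlonglongrightarrow> x" and z: "(\<lambda>n. step (xs n)) \<longlonglongrightarrow> z"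
  have opt: "(\<lambda>n. opt (xs n)) \<longlonglongrightarrow> opt x"
    by (rule continuous_on_tendsto_compose[OF continuous_on_opt[OF D] x(2,1)]) (use xs in auto)
  have tendsto_F: "(\<lambda>n. \<xi> (step (xs n))) \<longlonglongrightarrow> \<xi> z" if "\<xi> \<in> F" for \<xi>
    by (rule continuous_on_tendsto_compose[OF F_continuous[OF that, where S = UNIV] z]) auto
  have "z \<in> K"
    by (rule closed_sequentially[OF compact_imp_closed[OF K(1)] _ z]) (use K xs in auto)
  have "step x = z"
    unfolding step_def
  proof (rule grad_unique[OF comb_in_F])
    show "z \<in> E0" using \<open>z \<in> K\<close> K by auto
    fix \<zeta> assume \<zeta>: "\<zeta> \<in> F"
    have "Phi x (comb (opt x)) \<le> Phi x \<zeta> - (\<zeta> z - comb (opt x) z)"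
    proof (rule Phi_le_limit[OF _ _ x(2) comb_in_F comb_in_F])
      show "(\<lambda>n. comb (opt (xs n)) w) \<longlonglongrightarrow> comb (opt x) w" for w
        by (rule comb_tendsto[OF opt]) simp
      show "Phi (xs n) (comb (opt (xs n))) \<le>
          Phi (xs n) \<zeta> - (\<zeta> (step (xs n)) - comb (opt (xs n)) (step (xs n)))" for n
        using grad_subgradient[OF comb_in_F \<zeta>, of "xs n" "opt (xs n)"] by (simp add: step_def)
      have "(\<lambda>n. Phi (xs n) \<zeta>) \<longlonglongrightarrow> Phi x \<zeta>"
        by (rule continuous_on_tendsto_compose[OF F_continuous_Phi[OF \<zeta>, where S = UNIV] x(2)]) auto
      then show "(\<lambda>n. Phi (xs n) \<zeta> - (\<zeta> (step (xs n)) - comb (opt (xs n)) (step (xs n))))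
          \<longlonglongrightarrow> Phi x \<zeta> - (\<zeta> z - comb (opt x) z)"
        by (intro tendsto_intros tendsto_F \<zeta> comb_tendsto[OF opt])
    qed (use xs x D in auto)
    then show "Phi x (comb (opt x)) + (\<zeta> z - comb (opt x) z) \<le> Phi x \<zeta>" by simp
  qed
  then show "z = step x" ..
qed

end

lemma (in dual_setting) exists_fixed_point_near:
  assumes y0: "y0 \<in> E0" and r: "r > 0"
    and le: "\<And>x. x \<in> E0 \<Longrightarrow> dist x y0 < r \<Longrightarrow> phistar F Phi x y0 \<le> ereal l"
  obtains x \<xi> where "x \<in> E0" "\<xi> \<in> F" "dist x y0 < r" "grad x \<xi> = x" "phistar F Phi x x \<le> ereal l"
proof -
  have "phistar F Phi y0 y0 \<le> ereal l" using le y0 r by simp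
  then have fin: "phistar F Phi y0 y0 < \<infinity>"
    by (cases "phistar F Phi y0 y0") auto
  have l: "l \<ge> 0"
    using order_trans[OF phistar_nonneg \<open>phistar F Phi y0 y0 \<le> ereal l\<close>] by simp
  obtain U where U: "open U" "y0 \<in> U"
    "(\<Union>y\<in>U. {z. phistar F Phi y z \<le> ereal l}) \<subseteq> E0"
    "compact (closure (\<Union>y\<in>U. {z. phistar F Phi y z \<le> ereal l}))"
    using A7[OF fin] l by blast
  define K where "K = closure (\<Union>y\<in>U. {z. phistar F Phi y z \<le> ereal l})"
  have K: "compact K" "K \<subseteq> E0"
    using U E0_closed by (auto simp: K_def closure_minimal)
  obtain s where s: "s > 0" "cball y0 s \<subseteq> U"
    using U(1,2) by (meson open_contains_cball)
  \<comment> \<open>Half of \<open>r\<close> lets a closed ball fit in the open one; the order of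
    choice is \<open>\<rho>\<close>, then \<open>\<tau>\<close>, then
    \<open>\<delta>\<close>.\<close>
  define \<rho> where "\<rho> = min (r / 2) s"
  have \<rho>: "\<rho> > 0" "\<rho> < r" "cball y0 \<rho> \<subseteq> U"
    using r s by (auto simp: \<rho>_def)
  obtain \<eta> :: "nat \<Rightarrow> 'e \<Rightarrow> real" and m \<tau> where \<eta>: "\<And>j. j < m \<Longrightarrow> \<eta> j \<in> F" and \<tau>: "\<tau> > 0"
    and near: "\<And>z. z \<in> K \<Longrightarrow> (\<And>j. j < m \<Longrightarrow> \<bar>\<eta> j z - \<eta> j y0\<bar> \<le> \<tau>) \<Longrightarrow> dist z y0 < \<rho>"
    by (rule finite_weak_neighbourhood[OF K y0 \<rho>(1)]) blast
  \<comment> \<open>Chosen so that the error \<open>sqrt (2 * l * \<delta>)\<close> is at most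
    \<open>\<tau>\<close>; the summand 1 covers \<open>l = 0\<close>.\<close>
  define \<delta> where "\<delta> = \<tau>\<^sup>2 / (2 * l + 1)"
  have \<delta>: "\<delta> > 0" using \<tau> l by (simp add: \<delta>_def)
  have "2 * l * \<delta> \<le> \<tau>\<^sup>2"
    using l by (simp add: \<delta>_def divide_le_eq algebra_simps)
  then have sqrt_le: "sqrt (2 * l * \<delta>) \<le> \<tau>"
    using \<tau> by (simp add: real_le_lsqrt l)
  interpret galerkin E0 F Phi \<eta> m y0 \<delta> l
    by unfold_locales (use \<eta> \<delta> l in auto)
  define D where "D = cball y0 \<rho> \<inter> E0"
  have D: "D \<subseteq> E0" "\<And>x. x \<in> D \<Longrightarrow> phistar F Phi x y0 \<le> ereal l"
    using le \<rho> by (auto simp: D_def dist_commute)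
  have stepK: "step x \<in> K" if "x \<in> D" for x
  proof -
    have "step x \<in> (\<Union>y\<in>U. {z. phistar F Phi y z \<le> ereal l})"
      using phistar_step_le[OF _ D(2)[OF that]] that \<rho>(3) by (auto simp: D_def)
    then show ?thesis
      unfolding K_def by (rule subsetD[OF closure_subset])
  qed
  have near_step: "dist (step x) y0 < \<rho>" if "x \<in> D" for x
  proof (rule near[OF stepK[OF that]])
    fix j assume "j < m"
    from step_close[OF subsetD[OF D(1) that] D(2)[OF that] this]
    show "\<bar>\<eta> j (step x) - \<eta> j y0\<bar> \<le> \<tau>"
      using sqrt_le by (rule order_trans)
  qed
  obtain x where x: "x \<in> D" "step x = x"
  proof (rule schauder_fixed_point[of D "K \<inter> cball y0 \<rho>" step])
    show "convex D"
      unfolding D_def using E0_subspace by (intro convex_Int convex_cball subspace_imp_convex)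
    have "y0 \<in> D" using y0 \<rho> by (simp add: D_def)
    then show "D \<noteq> {}" by blast
    show "compact (K \<inter> cball y0 \<rho>)" using K by (intro compact_Int_closed) auto
    show "continuous_on D step"
      by (rule continuous_on_step[OF D K]) (use stepK in auto)
    show "step x \<in> K \<inter> cball y0 \<rho>" if "x \<in> D" for x
      using stepK[OF that] near_step[OF that] by (simp add: dist_commute)
  qed (use K in \<open>auto simp: D_def\<close>)
  show thesis
  proof (rule that[of x "comb (opt x)"])
    show "dist x y0 < r" using near_step[OF x(1)] x \<rho> by simp
    show "phistar F Phi x x \<le> ereal l"
      using phistar_step_le[OF _ D(2)[OF x(1)]] x D by auto
    show "grad x (comb (opt x)) = x" using x by (simp add: step_def)
  qed (use x D comb_in_F in auto)
qed

section \<open>The tilted measures\<close>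

text \<open>In a nonseparable space \<open>ball_sigma\<close> can be smaller than the Borel sets,
  but a compact set is a countable intersection of finite unions of balls.\<close>

lemma compact_in_sets_ball_sigma:
  fixes K :: "'e::metric_space set"
  assumes "compact K"
  shows "K \<in> sets ball_sigma"
proof -
  have "\<exists>C. finite C \<and> C \<subseteq> K \<and> K \<subseteq> (\<Union>x\<in>C. ball x (inverse (real (Suc n))))" for n
    by (rule compactE_image[OF assms, of K "\<lambda>x. ball x (inverse (real (Suc n)))"]) auto
  then obtain C where C: "\<And>n. finite (C n)" "\<And>n. C n \<subseteq> K"
    "\<And>n. K \<subseteq> (\<Union>x\<in>C n. ball x (inverse (real (Suc n))))"
    by metis
  have "z \<in> K" if z: "\<And>n. z \<in> (\<Union>x\<in>C n. ball x (inverse (real (Suc n))))" for z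
  proof -
    have "\<exists>y\<in>K. dist y z < e" if "e > 0" for e
    proof -
      obtain n where n: "inverse (real (Suc n)) < e"
        using \<open>e > 0\<close> reals_Archimedean by blast
      obtain y where "y \<in> C n" "dist y z < inverse (real (Suc n))"
        using z[of n] by auto
      then show ?thesis
        using n C(2)[of n] by (intro bexI[of _ y]) auto
    qed
    then have "z \<in> closure K" by (simp add: closure_approachable)
    then show "z \<in> K"
      using compact_imp_closed[OF assms] by (simp add: closure_closed)
  qed
  then have "(\<Inter>n. \<Union>x\<in>C n. ball x (inverse (real (Suc n)))) \<subseteq> K"
    by (meson INT_D UNIV_I subsetI)
  with C(3) have "K = (\<Inter>n. \<Union>x\<in>C n. ball x (inverse (real (Suc n))))"
    by (intro equalityI INT_greatest)
  also have "\<dots> \<in> sets ball_sigma"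
    using C(1) by (intro sets.countable_INT sets.finite_UN) auto
  finally show ?thesis .
qed

lemma elog_le_imp:
  assumes "ereal (1 / a) * elog p \<le> ereal (- b)" "a > 0" "p \<ge> 0"
  shows "p \<le> exp (- a * b)"
proof (cases "p = 0")
  case False
  then have "ln p / a \<le> - b"
    using assms(1) by (simp add: elog_def)
  then have "ln p \<le> - a * b"
    using assms(2) by (simp add: divide_le_eq mult.commute)
  then have "exp (ln p) \<le> exp (- a * b)" by simp
  then show ?thesis
    using False assms(3) by simp
qed simp

lemma le_elog:
  assumes "p \<ge> 1/2 * exp (- a * b)" "a > 0"
  shows "ereal (1 / a) * elog p \<ge> ereal (- b - ln 2 / a)"
proof -
  have "p > 0"
    using assms(1) exp_gt_zero[of "- a * b"] by linarith
  have "ln (1/2 * exp (- a * b)) \<le> ln p"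
    using assms(1) \<open>p > 0\<close> by simp
  then have "- ln 2 - a * b \<le> ln p"
    by (simp add: ln_mult ln_div)
  then have "(- ln 2 - a * b) / a \<le> ln p / a"
    using assms(2) by (intro divide_right_mono) auto
  then show ?thesis
    using \<open>p > 0\<close> assms(2) by (simp add: elog_def diff_divide_distrib)
qed

context dual_setting
begin

text \<open>Used in the contrapositive: away from a solution of the gradient equation some
  \<open>\<zeta>\<close> does strictly better than \<open>\<xi>\<close>.\<close>

lemma maximal_imp_grad_eq:
  assumes "\<xi> \<in> F" and le: "\<And>\<zeta>. \<zeta> \<in> F \<Longrightarrow> \<zeta> z - Phi z \<zeta> \<le> \<xi> z - Phi z \<xi>"
  shows "z \<in> E0" "grad z \<xi> = z"
proof -
  have "phistar F Phi z z \<le> ereal (\<xi> z - Phi z \<xi>)"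
    using le by (simp add: phistar_le_iff)
  then show z: "z \<in> E0"
    by (intro phistar_finite_imp_E0) (cases "phistar F Phi z z"; auto)
  show "grad z \<xi> = z"
    by (rule grad_unique[OF assms(1) z]) (use le in \<open>force simp: algebra_simps\<close>)
qed

text \<open>Indexing the cover by pairs of a functional and a gap makes compactness yield finitely
  many functionals and one uniform gap.\<close>

lemma finite_improvement:
  assumes K: "compact K" and \<xi>: "\<xi> \<in> F"
    and impr: "\<And>z. z \<in> K \<Longrightarrow> \<exists>\<zeta>\<in>F. \<zeta> z - Phi z \<zeta> > \<xi> z - Phi z \<xi>"
  obtains Z c where "finite Z" "Z \<subseteq> F" "c > 0"
    "\<And>z. z \<in> K \<Longrightarrow> \<exists>\<zeta>\<in>Z. \<zeta> z - Phi z \<zeta> \<ge> \<xi> z - Phi z \<xi> + c"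
proof -
  let ?V = "\<lambda>p. {w. snd p < (fst p w - Phi w (fst p)) - (\<xi> w - Phi w \<xi>)}"
  have "open (?V p)" if "p \<in> F \<times> {0<..}" for p
  proof -
    have p: "fst p \<in> F" using that by auto
    show ?thesis
      by (intro open_Collect_less continuous_on_diff continuous_on_const
          F_continuous[OF p] F_continuous_Phi[OF p] F_continuous[OF \<xi>] F_continuous_Phi[OF \<xi>])
  qed
  moreover have "K \<subseteq> (\<Union>p\<in>F \<times> {0<..}. ?V p)"
  proof
    fix z assume "z \<in> K"
    then obtain \<zeta> where "\<zeta> \<in> F" "\<zeta> z - Phi z \<zeta> > \<xi> z - Phi z \<xi>"
      using impr by blast
    then show "z \<in> (\<Union>p\<in>F \<times> {0<..}. ?V p)"
      by (intro UN_I[where a = "(\<zeta>, ((\<zeta> z - Phi z \<zeta>) - (\<xi> z - Phi z \<xi>)) / 2)"]) auto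
  qed
  ultimately obtain C where C: "C \<subseteq> F \<times> {0<..}" "finite C" "K \<subseteq> (\<Union>p\<in>C. ?V p)"
    by (rule compactE_image[OF K])
  define c where "c = Min (insert 1 (snd ` C))"
  show thesis
  proof (rule that[of "fst ` C" c])
    have "snd q > 0" if "q \<in> C" for q
      using that C(1) by (auto simp: mem_Times_iff)
    then show "c > 0"
      using C(2) by (simp add: c_def)
    fix z assume "z \<in> K"
    then obtain p where p: "p \<in> C" "z \<in> ?V p" using C(3) by blast
    then have "c \<le> snd p"
      unfolding c_def using C(2) by (intro Min_le) auto
    then show "\<exists>\<zeta>\<in>fst ` C. \<zeta> z - Phi z \<zeta> \<ge> \<xi> z - Phi z \<xi> + c"
      using p by (intro bexI[of _ "fst p"]) auto
  qed (use C in auto)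
qed

end

locale ldp_setting = dual_setting E0 F Phi
  for E0 :: "'e::banach set" and F and Phi +
  fixes a :: "nat \<Rightarrow> real"
    and Phin :: "nat \<Rightarrow> 'e \<Rightarrow> ('e \<Rightarrow> real) \<Rightarrow> real"
    and M :: "nat \<Rightarrow> 'w measure"
    and Y :: "nat \<Rightarrow> 'w \<Rightarrow> 'e"
  assumes a_pos: "\<And>n. a n > 0"
    and a_lim: "filterlim a at_top sequentially"
    and M_prob: "\<And>n. prob_space (M n)"
    and Y_meas: "\<And>n. Y n \<in> measurable (M n) ball_sigma"
    and A1: "\<And>n \<xi>. \<xi> \<in> F \<Longrightarrow> (\<lambda>x. Phin n x \<xi>) \<in> borel_measurable ball_sigma"
    and A3: "\<And>\<xi> K. \<xi> \<in> F \<Longrightarrow> compact K \<Longrightarrow>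
               uniform_limit K (\<lambda>n x. Phin n x (\<lambda>y. a n * \<xi> y) / a n) (\<lambda>x. Phi x \<xi>) sequentially"
    and A4: "\<And>n \<xi>. \<xi> \<in> F \<Longrightarrow>
               (\<integral>\<^sup>+ \<omega>. ennreal (exp (\<xi> (Y n \<omega>) - Phin n (Y n \<omega>) \<xi>)) \<partial>M n) = 1"
    and A5: "exp_tight M Y a"
    and A6: "\<And>\<xi>. \<xi> \<in> F \<Longrightarrow>
               limsup (\<lambda>n. SUP x. ereal \<bar>Phin n x (\<lambda>y. a n * \<xi> y) / a n\<bar>) < \<infinity>"
    and A10: "\<And>\<xi>. \<xi> \<in> F \<Longrightarrow>
               \<forall>x\<in>E0. \<forall>x'\<in>E0. x = gateaux_grad F E0 (Phi x) \<xi> \<longrightarrow>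
                 x' = gateaux_grad F E0 (Phi x') \<xi> \<longrightarrow> x = x'"
    and A11: "\<And>x0 \<epsilon>. phistar F Phi x0 x0 < \<infinity> \<Longrightarrow> \<epsilon> > 0 \<Longrightarrow>
               \<exists>y0\<in>ball x0 \<epsilon>. y0 \<in> E0 \<and>
                 Limsup (at y0 within E0) (\<lambda>y. phistar F Phi y y0) \<le> phistar F Phi y0 y0 \<and>
                 phistar F Phi y0 y0 \<le> phistar F Phi x0 x0 + ereal \<epsilon>"
begin

section \<open>Laws on \<open>E\<close> and their tilted densities\<close>

definition law :: "nat \<Rightarrow> 'e measure" where
  "law n = distr (M n) ball_sigma (Y n)"

lemma sets_law [simp, measurable_cong]: "sets (law n) = sets ball_sigma"
  by (simp add: law_def)

lemma space_law [simp]: "space (law n) = UNIV"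
  by (simp add: law_def)

lemma prob_space_law: "prob_space (law n)"
  unfolding law_def by (intro prob_space.prob_space_distr M_prob Y_meas)

lemma measure_law:
  "A \<in> sets ball_sigma \<Longrightarrow> measure (M n) {\<omega> \<in> space (M n). Y n \<omega> \<in> A} = measure (law n) A"
  unfolding law_def by (subst measure_distr[OF Y_meas]) (auto intro!: arg_cong[where f = "measure _"])

definition logdens :: "nat \<Rightarrow> ('e \<Rightarrow> real) \<Rightarrow> 'e \<Rightarrow> real" where
  "logdens n \<xi> w = a n * \<xi> w - Phin n w (\<lambda>y. a n * \<xi> y)"

lemma logdens_measurable [measurable]:
  assumes "\<xi> \<in> F"
  shows "logdens n \<xi> \<in> borel_measurable ball_sigma"
proof -
  note [measurable] = A1[OF F_scale[OF assms], of n "a n"] F_meas[OF assms]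
  show ?thesis unfolding logdens_def by measurable
qed

lemma integral_logdens:
  assumes "\<xi> \<in> F"
  shows "(\<integral>\<^sup>+ w. ennreal (exp (logdens n \<xi> w)) \<partial>law n) = 1"
proof -
  note [measurable] = logdens_measurable[OF assms, of n]
  have "(\<integral>\<^sup>+ w. ennreal (exp (logdens n \<xi> w)) \<partial>law n)
      = (\<integral>\<^sup>+ \<omega>. ennreal (exp (logdens n \<xi> (Y n \<omega>))) \<partial>M n)"
    unfolding law_def by (rule nn_integral_distr[OF Y_meas]) measurable
  then show ?thesis
    using A4[OF F_scale[OF assms], of n "a n"] by (simp add: logdens_def)
qed

text \<open>Off \<open>K\<close> the tilted density is controlled by \<open>exp t \<le> s * exp (2 * t) + 1 / s\<close>, which
  replaces Cauchy-Schwarz.\<close>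

lemma tilted_mass_bound:
  assumes \<xi>: "\<xi> \<in> F" and Z: "finite Z" "Z \<subseteq> F" and s: "s > 0"
    and K: "K \<in> sets ball_sigma" and B: "B \<in> sets ball_sigma"
    and off: "\<And>w. w \<notin> K \<Longrightarrow> 2 * logdens n \<xi> w \<le> logdens n (\<lambda>y. 2 * \<xi> y) w + a n * C"
    and far: "\<And>w. w \<in> K \<Longrightarrow> w \<notin> B \<Longrightarrow> \<exists>\<zeta>\<in>Z. logdens n \<xi> w \<le> logdens n \<zeta> w - a n * c"
    and near: "\<And>w. w \<in> K \<Longrightarrow> w \<in> B \<Longrightarrow> logdens n \<xi> w \<le> a n * v"
  shows "1 \<le> s * exp (a n * C) + 1 / s * measure (law n) (- K)
     + exp (- a n * c) * card Z + exp (a n * v) * measure (law n) B"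
proof -
  interpret prob_space "law n" by (rule prob_space_law)
  have \<xi>2: "(\<lambda>y. 2 * \<xi> y) \<in> F" using F_scale[OF \<xi>] .
  note [measurable] = logdens_measurable[OF \<xi>] logdens_measurable[OF \<xi>2] B K
  have [measurable]: "logdens n \<zeta> \<in> borel_measurable ball_sigma" if "\<zeta> \<in> Z" for \<zeta>
    using that Z by (auto intro: logdens_measurable)
  have Kc [measurable]: "- K \<in> sets ball_sigma"
    using sets.compl_sets[OF K] by (simp add: Compl_eq_Diff_UNIV)
  let ?E = "\<lambda>\<zeta> w. ennreal (exp (logdens n \<zeta> w))"
  \<comment> \<open>Off \<open>K\<close> the first two summands dominate, on \<open>K - B\<close>
    the third, on the rest the fourth. The integrals are explicit because every tilted density has
    mass 1.\<close>
  let ?g = "\<lambda>w. ennreal (s * exp (a n * C)) * ?E (\<lambda>y. 2 * \<xi> y) w + ennreal (1 / s) * indicator (- K) w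
     + ennreal (exp (- a n * c)) * (\<Sum>\<zeta>\<in>Z. ?E \<zeta> w) + ennreal (exp (a n * v)) * indicator B w"
  have le: "?E \<xi> w \<le> ?g w" for w
  proof -
    consider "w \<notin> K" | "w \<in> K" "w \<notin> B" | "w \<in> K" "w \<in> B" by blast
    then show ?thesis
    proof cases
      case 1
      define t where "t = logdens n \<xi> w"
      have "exp t \<le> s * exp (a n * C) * exp (logdens n (\<lambda>y. 2 * \<xi> y) w) + 1 / s"
      proof (cases "exp t \<le> 1 / s")
        case False
        then have "1 \<le> s * exp t"
          using s by (simp add: field_simps)
        then have "1 * exp t \<le> s * exp t * exp t"
          by (intro mult_right_mono) auto
        also have "s * exp t * exp t = s * exp (2 * t)"
          by (simp only: mult_2 exp_add mult.assoc)
        also have "\<dots> \<le> s * exp (a n * C + logdens n (\<lambda>y. 2 * \<xi> y) w)"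
          using off[OF 1] s by (simp add: t_def)
        also have "\<dots> = s * exp (a n * C) * exp (logdens n (\<lambda>y. 2 * \<xi> y) w)"
          by (simp only: exp_add mult.assoc)
        finally have "exp t \<le> s * exp (a n * C) * exp (logdens n (\<lambda>y. 2 * \<xi> y) w)"
          by simp
        moreover have "0 \<le> 1 / s" using s by simp
        ultimately show ?thesis by linarith
      qed (use s in \<open>simp add: add_increasing\<close>)
      then have "?E \<xi> w \<le> ennreal (s * exp (a n * C) * exp (logdens n (\<lambda>y. 2 * \<xi> y) w) + 1 / s)"
        unfolding t_def by (rule ennreal_leI)
      also have "\<dots> = ennreal (s * exp (a n * C)) * ?E (\<lambda>y. 2 * \<xi> y) w + ennreal (1 / s) * indicator (- K) w"
        using s 1 by (simp add: ennreal_mult)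
      also have "\<dots> \<le> ?g w"
        by (simp add: add.assoc)
      finally show ?thesis .
    next
      case 2
      then obtain \<zeta> where \<zeta>: "\<zeta> \<in> Z" "logdens n \<xi> w \<le> logdens n \<zeta> w - a n * c"
        using far by blast
      then have "exp (logdens n \<xi> w) \<le> exp (- a n * c + logdens n \<zeta> w)"
        by simp
      then have "exp (logdens n \<xi> w) \<le> exp (- a n * c) * exp (logdens n \<zeta> w)"
        by (simp only: exp_add)
      then have "?E \<xi> w \<le> ennreal (exp (- a n * c)) * ?E \<zeta> w"
        by (simp add: ennreal_leI flip: ennreal_mult)
      also have "\<dots> \<le> ennreal (exp (- a n * c)) * (\<Sum>\<zeta>\<in>Z. ?E \<zeta> w)"
        using \<zeta>(1) Z(1) by (intro mult_left_mono member_le_sum) auto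
      also have "\<dots> \<le> ?g w"
        by (intro add_increasing2[OF zero_le] add_increasing[OF zero_le order_refl])
      finally show ?thesis .
    next
      case 3
      then have "?E \<xi> w \<le> ennreal (exp (a n * v)) * indicator B w"
        using near by (simp add: ennreal_leI)
      also have "\<dots> \<le> ?g w"
        by (intro add_increasing[OF zero_le order_refl])
      finally show ?thesis .
    qed
  qed
  have "1 = (\<integral>\<^sup>+ w. ?E \<xi> w \<partial>law n)"
    using integral_logdens[OF \<xi>] by simp
  also have "\<dots> \<le> (\<integral>\<^sup>+ w. ?g w \<partial>law n)"
    by (intro nn_integral_mono le)
  also have "\<dots> = ennreal (s * exp (a n * C)) * (\<integral>\<^sup>+ w. ?E (\<lambda>y. 2 * \<xi> y) w \<partial>law n)
     + ennreal (1 / s) * emeasure (law n) (- K)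
     + ennreal (exp (- a n * c)) * (\<Sum>\<zeta>\<in>Z. \<integral>\<^sup>+ w. ?E \<zeta> w \<partial>law n)
     + ennreal (exp (a n * v)) * emeasure (law n) B"
    by (simp add: nn_integral_add nn_integral_cmult nn_integral_sum del: sum_ennreal)
  also have "(\<integral>\<^sup>+ w. ?E (\<lambda>y. 2 * \<xi> y) w \<partial>law n) = 1"
    by (rule integral_logdens[OF \<xi>2])
  also have "(\<Sum>\<zeta>\<in>Z. \<integral>\<^sup>+ w. ?E \<zeta> w \<partial>law n) = ennreal (real (card Z))"
    using integral_logdens Z(2) by (subst sum.cong[OF refl, of Z _ "\<lambda>_. 1"]) (auto simp: ennreal_of_nat_eq_real_of_nat)
  finally have bound: "1 \<le> ennreal (s * exp (a n * C)) * 1 + ennreal (1 / s) * emeasure (law n) (- K)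
     + ennreal (exp (- a n * c)) * ennreal (real (card Z)) + ennreal (exp (a n * v)) * emeasure (law n) B" .
  define q where "q = 1 / s"
  have "q \<ge> 0" using s by (simp add: q_def)
  then have "1 \<le> ennreal (s * exp (a n * C) + q * prob (- K)
     + exp (- a n * c) * card Z + exp (a n * v) * prob B)"
    using bound s unfolding q_def[symmetric] by (simp add: emeasure_eq_measure ennreal_mult ennreal_plus)
  then show ?thesis
    unfolding q_def by simp
qed

lemma eventually_Phin_bounded:
  assumes "\<xi> \<in> F"
  obtains C where "C \<ge> 0" "\<forall>\<^sub>F n in sequentially. \<forall>w. \<bar>Phin n w (\<lambda>y. a n * \<xi> y)\<bar> \<le> a n * C"
proof -
  let ?S = "\<lambda>n. SUP x. ereal \<bar>Phin n x (\<lambda>y. a n * \<xi> y) / a n\<bar>"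
  obtain k :: nat where "limsup ?S < ereal (real k)"
    using less_PInf_Ex_of_nat A6[OF assms] by auto
  then have "\<forall>\<^sub>F n in sequentially. ?S n < ereal (real k)"
    by (rule Limsup_lessD)
  then have "\<forall>\<^sub>F n in sequentially. \<forall>w. \<bar>Phin n w (\<lambda>y. a n * \<xi> y)\<bar> \<le> a n * real k"
  proof eventually_elim
    case (elim n)
    have "\<bar>Phin n w (\<lambda>y. a n * \<xi> y)\<bar> \<le> a n * real k" for w
    proof -
      have "ereal \<bar>Phin n w (\<lambda>y. a n * \<xi> y) / a n\<bar> \<le> ?S n"
        by (rule SUP_upper) simp
      then have "ereal \<bar>Phin n w (\<lambda>y. a n * \<xi> y) / a n\<bar> < ereal (real k)"
        using elim by (rule le_less_trans)
      then show ?thesis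
        using a_pos[of n] by (simp add: abs_divide pos_divide_less_eq mult.commute)
    qed
    then show ?case ..
  qed
  then show thesis using that[of "real k"] by simp
qed

lemma exp_tight_law:
  assumes "b > 0"
  obtains K where "compact K" "\<forall>\<^sub>F n in sequentially. measure (law n) (- K) \<le> exp (- a n * b)"
    "limsup (\<lambda>n. ereal (1 / a n) * elog (measure (law n) (- K))) \<le> ereal (- (b + 1))"
proof -
  \<comment> \<open>Tightness at rate \<open>b + 1\<close> makes the limsup strictly less than
    \<open>- b\<close>, hence an eventual bound at rate \<open>b\<close>.\<close>
  have "b + 1 > 0" using assms by simp
  then obtain K where K: "compact K"
    "limsup (\<lambda>n. ereal (1 / a n) * elog (measure (M n) {\<omega>\<in>space (M n). Y n \<omega> \<notin> K})) \<le> ereal (- (b + 1))"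
    using A5 unfolding exp_tight_def by blast
  have "- K \<in> sets ball_sigma"
    using sets.compl_sets[OF compact_in_sets_ball_sigma[OF K(1)]] by (simp add: Compl_eq_Diff_UNIV)
  from measure_law[OF this] have eq: "measure (M n) {\<omega>\<in>space (M n). Y n \<omega> \<notin> K} = measure (law n) (- K)" for n
    by simp
  have "limsup (\<lambda>n. ereal (1 / a n) * elog (measure (law n) (- K))) < ereal (- b)"
    using K(2) unfolding eq by (rule le_less_trans) simp
  then have "\<forall>\<^sub>F n in sequentially. ereal (1 / a n) * elog (measure (law n) (- K)) < ereal (- b)"
    by (rule Limsup_lessD)
  then have "\<forall>\<^sub>F n in sequentially. measure (law n) (- K) \<le> exp (- a n * b)"
    by eventually_elim (intro elog_le_imp a_pos; simp)
  then show thesis using that K unfolding eq by blast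
qed

lemma eventually_exp_small:
  assumes "c > 0" "e > 0"
  shows "\<forall>\<^sub>F n in sequentially. exp (- a n * c) * k \<le> e"
proof -
  have "filterlim (\<lambda>n. c * a n) at_top sequentially"
    by (rule filterlim_tendsto_pos_mult_at_top[OF tendsto_const assms(1) a_lim])
  then have "((\<lambda>n. exp (- (c * a n))) \<longlongrightarrow> 0) sequentially"
    by (intro filterlim_compose[OF exp_at_bot]) (simp add: filterlim_uminus_at_bot)
  then have "((\<lambda>n. exp (- a n * c) * k) \<longlongrightarrow> 0 * k) sequentially"
    by (intro tendsto_mult tendsto_const) (simp add: mult.commute)
  then have "\<forall>\<^sub>F n in sequentially. exp (- a n * c) * k < e"
    using assms(2) by (intro order_tendstoD) auto
  then show ?thesis by eventually_elim simp
qed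

text \<open>Three of the four terms in \<open>tilted_mass_bound\<close> are eventually at most 1/8,
  so the ball term exceeds 1/2; dividing by the largest tilted density on the ball removes the
  tilt.\<close>

lemma ball_lower_bound:
  assumes \<xi>: "\<xi> \<in> F" and x: "x \<in> E0" "grad x \<xi> = x" and r: "r > 0" and e: "e > 0"
  shows "\<forall>\<^sub>F n in sequentially.
    1/2 * exp (- a n * (\<xi> x - Phi x \<xi> + e)) \<le> measure (law n) (ball x r)"
proof -
  have \<xi>2: "(\<lambda>y. 2 * \<xi> y) \<in> F" using F_scale[OF \<xi>] .
  have "isCont (\<lambda>w. \<xi> w - Phi w \<xi>) x"
    using continuous_on_diff[OF F_continuous[OF \<xi>] F_continuous_Phi[OF \<xi>], of UNIV]
    by (simp add: continuous_on_eq_continuous_at)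
  then obtain d where d: "d > 0"
    "\<And>w. dist w x < d \<Longrightarrow> dist (\<xi> w - Phi w \<xi>) (\<xi> x - Phi x \<xi>) < e / 2"
    using e unfolding continuous_at_eps_delta by (meson half_gt_zero)
  define B where "B = ball x (min r d)"
  have B: "B \<in> sets ball_sigma" "B \<subseteq> ball x r" by (auto simp: B_def)
  obtain C1 where C1: "C1 \<ge> 0" "\<forall>\<^sub>F n in sequentially. \<forall>w. \<bar>Phin n w (\<lambda>y. a n * \<xi> y)\<bar> \<le> a n * C1"
    by (rule eventually_Phin_bounded[OF \<xi>])
  obtain C2 where C2: "C2 \<ge> 0"
    "\<forall>\<^sub>F n in sequentially. \<forall>w. \<bar>Phin n w (\<lambda>y. a n * (2 * \<xi> y))\<bar> \<le> a n * C2"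
    by (rule eventually_Phin_bounded[OF \<xi>2])
  \<comment> \<open>In \<open>2 * logdens n \<xi> w - logdens n (\<lambda>y. 2 * \<xi> y) w\<close>
    the linear parts cancel, leaving one \<open>Phin\<close> term at \<open>2 * \<xi>\<close> and
    twice the one at \<open>\<xi>\<close>.\<close>
  define C where "C = C2 + 2 * C1"
  have "C + 1 > 0" using C1 C2 by (simp add: C_def)
  then obtain K where K: "compact K"
    "\<forall>\<^sub>F n in sequentially. measure (law n) (- K) \<le> exp (- a n * (C + 1))"
    by (rule exp_tight_law)
  \<comment> \<open>Here \<open>A10\<close> enters: without improvement \<open>z\<close> would solve
    the gradient equation and equal \<open>x\<close>, which lies in \<open>B\<close>.\<close>
  have "\<exists>\<zeta>\<in>F. \<zeta> z - Phi z \<zeta> > \<xi> z - Phi z \<xi>" if z: "z \<in> K - B" for z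
  proof (rule ccontr)
    assume "\<not> ?thesis"
    then have "\<zeta> z - Phi z \<zeta> \<le> \<xi> z - Phi z \<xi>" if "\<zeta> \<in> F" for \<zeta>
      using that by (auto simp: not_less)
    from maximal_imp_grad_eq[OF \<xi> this] have "x = z"
      using A10[OF \<xi>] x by metis
    then show False using z r d(1) by (auto simp: B_def)
  qed
  moreover have "compact (K - B)"
    using K(1) by (intro compact_diff) (auto simp: B_def)
  ultimately obtain Z c where Z: "finite Z" "Z \<subseteq> F" and c: "c > 0"
    and impr: "\<And>z. z \<in> K - B \<Longrightarrow> \<exists>\<zeta>\<in>Z. \<zeta> z - Phi z \<zeta> \<ge> \<xi> z - Phi z \<xi> + c"
    using finite_improvement[OF _ \<xi>] by metis
  \<comment> \<open>Two approximation errors of \<open>c / 3\<close> leave a gap of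
    \<open>c / 3\<close>; \<open>e / 2\<close> joins the continuity error \<open>e / 2\<close> on
    \<open>B\<close>.\<close>
  define h where "h = min (c / 3) (e / 2)"
  have h: "h > 0" using c e by (simp add: h_def)
  have close: "\<forall>\<^sub>F n in sequentially. \<forall>w\<in>K. \<bar>logdens n \<zeta> w - a n * (\<zeta> w - Phi w \<zeta>)\<bar> \<le> a n * h"
    if "\<zeta> \<in> F" for \<zeta>
    using uniform_limitD[OF A3[OF that K(1)] h]
  proof eventually_elim
    case (elim n)
    show ?case
    proof
      fix w assume "w \<in> K"
      then have "\<bar>Phin n w (\<lambda>y. a n * \<zeta> y) / a n - Phi w \<zeta>\<bar> \<le> h"
        using elim by (force simp: dist_real_def)
      then have "a n * \<bar>Phin n w (\<lambda>y. a n * \<zeta> y) / a n - Phi w \<zeta>\<bar> \<le> a n * h"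
        using a_pos[of n] by simp
      moreover have "a n * \<bar>Phin n w (\<lambda>y. a n * \<zeta> y) / a n - Phi w \<zeta>\<bar>
          = \<bar>a n * (Phin n w (\<lambda>y. a n * \<zeta> y) / a n - Phi w \<zeta>)\<bar>"
        using a_pos[of n] by (simp add: abs_mult)
      moreover have "a n * (Phin n w (\<lambda>y. a n * \<zeta> y) / a n - Phi w \<zeta>)
          = - (logdens n \<zeta> w - a n * (\<zeta> w - Phi w \<zeta>))"
        using a_pos[of n] by (simp add: logdens_def right_diff_distrib)
      ultimately show "\<bar>logdens n \<zeta> w - a n * (\<zeta> w - Phi w \<zeta>)\<bar> \<le> a n * h" by simp
    qed
  qed
  have closeZ: "\<forall>\<^sub>F n in sequentially. \<forall>\<zeta>\<in>Z. \<forall>w\<in>K. \<bar>logdens n \<zeta> w - a n * (\<zeta> w - Phi w \<zeta>)\<bar> \<le> a n * h"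
    using close Z by (intro eventually_ball_finite) auto
  have small1: "\<forall>\<^sub>F n in sequentially. exp (- a n * 1) * 8 \<le> 1/8"
    by (rule eventually_exp_small) auto
  have small2: "\<forall>\<^sub>F n in sequentially. exp (- a n * (c / 3)) * real (card Z) \<le> 1/8"
    using c by (intro eventually_exp_small) auto
  define v where "v = \<xi> x - Phi x \<xi> + e"
  from C1(2) C2(2) K(2) close[OF \<xi>] closeZ small1 small2 show ?thesis
  proof eventually_elim
    case (elim n)
    have an: "a n > 0" by (rule a_pos)
    \<comment> \<open>With \<open>s = exp (- a n * C) / 8\<close> the first term is 1/8, and the
      extra 1 in the tightness rate makes the second at most \<open>8 * exp (- a n)\<close>.\<close>
    have "1 \<le> exp (- a n * C) / 8 * exp (a n * C) + 1 / (exp (- a n * C) / 8) * measure (law n) (- K)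
     + exp (- a n * (c / 3)) * card Z + exp (a n * v) * measure (law n) B"
    proof (rule tilted_mass_bound[OF \<xi> Z _ compact_in_sets_ball_sigma[OF K(1)] B(1)])
      fix w
      have "Phin n w (\<lambda>y. a n * (2 * \<xi> y)) - 2 * Phin n w (\<lambda>y. a n * \<xi> y) \<le> a n * C"
        using elim(1)[rule_format, of w] elim(2)[rule_format, of w] by (simp add: C_def distrib_left)
      then show "2 * logdens n \<xi> w \<le> logdens n (\<lambda>y. 2 * \<xi> y) w + a n * C"
        by (simp add: logdens_def right_diff_distrib)
      assume w: "w \<in> K"
      have cl: "\<bar>logdens n \<xi> w - a n * (\<xi> w - Phi w \<xi>)\<bar> \<le> a n * h"
        using elim(4) w by blast
      show "\<exists>\<zeta>\<in>Z. logdens n \<xi> w \<le> logdens n \<zeta> w - a n * (c / 3)" if "w \<notin> B"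
      proof -
        obtain \<zeta> where \<zeta>: "\<zeta> \<in> Z" "\<zeta> w - Phi w \<zeta> \<ge> \<xi> w - Phi w \<xi> + c"
          using impr[of w] w \<open>w \<notin> B\<close> by blast
        have "\<bar>logdens n \<zeta> w - a n * (\<zeta> w - Phi w \<zeta>)\<bar> \<le> a n * h"
          using elim(5) \<zeta>(1) w by blast
        moreover have "a n * (\<zeta> w - Phi w \<zeta>) \<ge> a n * (\<xi> w - Phi w \<xi>) + a n * c"
          using mult_left_mono[OF \<zeta>(2), of "a n"] an by (simp add: distrib_left)
        moreover have "a n * h \<le> a n * (c / 3)"
          using an by (simp add: h_def)
        moreover have "a n * c = a n * (c / 3) + a n * (c / 3) + a n * (c / 3)"
          by simp
        ultimately have "logdens n \<xi> w \<le> logdens n \<zeta> w - a n * (c / 3)"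
          using cl by linarith
        then show ?thesis
          using \<zeta>(1) by (intro bexI[of _ \<zeta>]) auto
      qed
      show "logdens n \<xi> w \<le> a n * v" if "w \<in> B"
      proof -
        have "dist w x < d" using that by (simp add: B_def dist_commute)
        from d(2)[OF this] have "\<xi> w - Phi w \<xi> \<le> \<xi> x - Phi x \<xi> + e / 2"
          unfolding dist_real_def by linarith
        then have "\<xi> w - Phi w \<xi> + h \<le> v"
          by (simp add: v_def h_def)
        then have "a n * (\<xi> w - Phi w \<xi> + h) \<le> a n * v"
          using an by simp
        then show ?thesis
          using cl by (simp add: distrib_left)
      qed
    qed auto
    moreover have "exp (- a n * C) / 8 * exp (a n * C) = 1/8"
      by (simp flip: exp_add)
    moreover have "1 / (exp (- a n * C) / 8) * measure (law n) (- K) \<le> 1/8"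
    proof -
      have "1 / (exp (- a n * C) / 8) * measure (law n) (- K) = 8 * exp (a n * C) * measure (law n) (- K)"
        by (simp add: exp_minus field_simps)
      also have "\<dots> \<le> 8 * exp (a n * C) * exp (- a n * (C + 1))"
        using elim(3) by (intro mult_left_mono) auto
      also have "\<dots> = exp (- a n * 1) * 8"
        by (simp add: algebra_simps flip: exp_add)
      finally show ?thesis using elim(6) by (rule order_trans)
    qed
    ultimately have "1/2 \<le> exp (a n * v) * measure (law n) B"
      using elim(7) by linarith
    also have "\<dots> \<le> exp (a n * v) * measure (law n) (ball x r)"
      using B by (intro mult_left_mono finite_measure.finite_measure_mono
          prob_space.finite_measure prob_space_law) auto
    finally have "exp (- a n * v) * (1/2) \<le> exp (- a n * v) * (exp (a n * v) * measure (law n) (ball x r))"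
      by (rule mult_left_mono) auto
    also have "\<dots> = measure (law n) (ball x r)"
      by (simp add: mult.assoc[symmetric] flip: exp_add)
    finally show ?case
      by (simp add: v_def mult.commute)
  qed
qed

section \<open>The large deviation lower bound\<close>

text \<open>The loss \<open>4 * e\<close> collects \<open>e'\<close> from \<open>A11\<close>,
  \<open>e\<close> from upper semicontinuity, \<open>e\<close> from \<open>ball_lower_bound\<close>
  and \<open>ln 2 / a n < e\<close> from its factor 1/2.\<close>

lemma lower_bound_real:
  assumes A: "A \<in> sets ball_sigma" and x0: "x0 \<in> interior A"
    and v: "phistar F Phi x0 x0 = ereal v" and e: "e > 0"
  shows "ereal (- v - 4 * e) \<le> liminf (\<lambda>n. ereal (1 / a n) * elog (measure (law n) A))"
proof -
  obtain d where d: "d > 0" "ball x0 d \<subseteq> A"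
    using x0 by (auto simp: mem_interior)
  \<comment> \<open>At most half of \<open>d\<close>, so that the two moves from \<open>x0\<close>
    to \<open>y0\<close> and from \<open>y0\<close> to \<open>x\<close> stay inside
    \<open>A\<close>.\<close>
  define e' where "e' = min e (d / 2)"
  have e': "e' > 0" "e' \<le> e" "2 * e' \<le> d"
    using e d by (auto simp: e'_def)
  obtain y0 where y0: "y0 \<in> ball x0 e'" "y0 \<in> E0"
    "Limsup (at y0 within E0) (\<lambda>y. phistar F Phi y y0) \<le> phistar F Phi y0 y0"
    "phistar F Phi y0 y0 \<le> phistar F Phi x0 x0 + ereal e'"
    using A11[of x0 e'] v e'(1) by auto
  define l where "l = v + e' + e"
  have y0l: "phistar F Phi y0 y0 < ereal l"
    using y0(4) e by (intro le_less_trans[OF y0(4)]) (simp add: v l_def)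
  then have "\<forall>\<^sub>F y in at y0 within E0. phistar F Phi y y0 < ereal l"
    using y0(3) by (intro Limsup_lessD) (rule le_less_trans)
  then obtain q where q: "q > 0" "\<And>y. y \<in> E0 \<Longrightarrow> y \<noteq> y0 \<Longrightarrow> dist y y0 < q \<Longrightarrow> phistar F Phi y y0 < ereal l"
    by (auto simp: eventually_at)
  define r where "r = min q e'"
  have "r > 0" using q e' by (simp add: r_def)
  \<comment> \<open>The limsup ignores the centre \<open>y0\<close>, which \<open>y0l\<close> covers
    separately.\<close>
  moreover have "phistar F Phi y y0 \<le> ereal l" if "y \<in> E0" "dist y y0 < r" for y
    using that q(2)[of y] y0l by (cases "y = y0") (auto simp: r_def intro: less_imp_le)
  ultimately obtain x \<xi> where x: "x \<in> E0" "\<xi> \<in> F" "dist x y0 < r" "grad x \<xi> = x"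
    "phistar F Phi x x \<le> ereal l"
    by (rule exists_fixed_point_near[OF y0(2)])
  have "dist x0 x < d"
    using dist_triangle[of x0 x y0] x(3) y0(1) e' by (simp add: r_def dist_commute)
  then have sub: "ball x (d - dist x0 x) \<subseteq> A"
    using d(2) by (auto simp: subset_iff) (smt (verit) dist_triangle)
  have le_l: "\<xi> x - Phi x \<xi> + e \<le> l + e"
    using x(2,5) by (simp add: phistar_le_iff)
  have "filterlim (\<lambda>n. ln 2 / a n) (nhds 0) sequentially"
    by (rule real_tendsto_divide_at_top[OF tendsto_const a_lim])
  then have "\<forall>\<^sub>F n in sequentially. ln 2 / a n < e"
    using e by (intro order_tendstoD) auto
  moreover have "\<forall>\<^sub>F n in sequentially.
    1/2 * exp (- a n * (\<xi> x - Phi x \<xi> + e)) \<le> measure (law n) (ball x (d - dist x0 x))"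
    using \<open>dist x0 x < d\<close> e by (intro ball_lower_bound x) auto
  ultimately have "\<forall>\<^sub>F n in sequentially.
      ereal (- v - 4 * e) \<le> ereal (1 / a n) * elog (measure (law n) A)"
  proof eventually_elim
    case (elim n)
    note elim(2)
    also have "measure (law n) (ball x (d - dist x0 x)) \<le> measure (law n) A"
      using sub A by (intro finite_measure.finite_measure_mono prob_space.finite_measure prob_space_law) auto
    finally have "ereal (- (\<xi> x - Phi x \<xi> + e) - ln 2 / a n) \<le> ereal (1 / a n) * elog (measure (law n) A)"
      by (rule le_elog[OF _ a_pos])
    moreover have "- v - 4 * e \<le> - (\<xi> x - Phi x \<xi> + e) - ln 2 / a n"
      using elim(1) le_l e' by (simp add: l_def)
    ultimately show ?case
      by (meson ereal_less_eq(3) order_trans)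
  qed
  then show ?thesis
    by (rule Liminf_bounded)
qed

lemma lower_bound:
  assumes A: "A \<in> sets ball_sigma" and x0: "x0 \<in> interior A"
  shows "- phistar F Phi x0 x0 \<le> liminf (\<lambda>n. ereal (1 / a n) * elog (measure (law n) A))"
    (is "_ \<le> ?L")
proof (cases "phistar F Phi x0 x0")
  case (real v)
  show ?thesis
  proof (rule ereal_le_epsilon2)
    fix e :: real assume "e > 0"
    then have "ereal (- v - 4 * (e / 4)) \<le> ?L"
      by (intro lower_bound_real[OF A x0 real]) simp
    then show "- phistar F Phi x0 x0 \<le> ?L + ereal e"
      by (cases ?L) (auto simp: real)
  qed
qed (use phistar_nonneg[of x0 x0] in auto)

text \<open>The lower bound for the open set \<open>- K\<close> contradicts exponential tightness if
  a point of rate at most \<open>l\<close> lies outside \<open>K\<close>. So the level set is a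
  closed subset of \<open>K\<close>.\<close>

lemma compact_level_set:
  assumes "l \<ge> 0"
  shows "compact {x. phistar F Phi x x \<le> ereal l}"
proof -
  \<comment> \<open>\<open>l + 1\<close> is positive even for \<open>l = 0\<close>, as
    \<open>exp_tight_law\<close> requires; the resulting limsup is at most
    \<open>- (l + 2)\<close>.\<close>
  obtain K where K: "compact K"
    "limsup (\<lambda>n. ereal (1 / a n) * elog (measure (law n) (- K))) \<le> ereal (- (l + 1 + 1))"
    using exp_tight_law[of "l + 1"] assms by auto
  have meas: "- K \<in> sets ball_sigma"
    using sets.compl_sets[OF compact_in_sets_ball_sigma[OF K(1)]] by (simp add: Compl_eq_Diff_UNIV)
  have "x \<in> K" if x: "phistar F Phi x x \<le> ereal l" for x
  proof (rule ccontr)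
    assume "x \<notin> K"
    then have "x \<in> interior (- K)"
      using compact_imp_closed[OF K(1)] by (simp add: interior_open open_Compl)
    then have "- phistar F Phi x x \<le> liminf (\<lambda>n. ereal (1 / a n) * elog (measure (law n) (- K)))"
      by (rule lower_bound[OF meas])
    also have "\<dots> \<le> limsup (\<lambda>n. ereal (1 / a n) * elog (measure (law n) (- K)))"
      by (rule Liminf_le_Limsup) simp
    also note K(2)
    finally show False
      using x by (cases "phistar F Phi x x") auto
  qed
  then have "{x. phistar F Phi x x \<le> ereal l} = K \<inter> {x. phistar F Phi x x \<le> ereal l}"
    by auto
  then show ?thesis
    using compact_Int_closed[OF K(1) closed_phistar_diagonal_le] by metis
qed

end

theorem theorem2p2:
  fixes E0 :: "'e::banach set"
    and F :: "('e \<Rightarrow> real) set"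
    and a :: "nat \<Rightarrow> real"
    and Phin :: "nat \<Rightarrow> 'e \<Rightarrow> ('e \<Rightarrow> real) \<Rightarrow> real"
    and Phi :: "'e \<Rightarrow> ('e \<Rightarrow> real) \<Rightarrow> real"
    and M :: "nat \<Rightarrow> 'w measure"
    and Y :: "nat \<Rightarrow> 'w \<Rightarrow> 'e"
  assumes E0_subspace: "subspace E0"
    and E0_closed: "closed E0"
    and E0_separable: "\<exists>D. countable D \<and> D \<subseteq> E0 \<and> E0 \<subseteq> closure D"
    \<comment> \<open>F is a vector space of linear functionals on E, identified with the dual of E0\<close>
    and F_zero: "(\<lambda>y. 0) \<in> F"
    and F_add: "\<And>\<xi> \<eta>. \<xi> \<in> F \<Longrightarrow> \<eta> \<in> F \<Longrightarrow> (\<lambda>y. \<xi> y + \<eta> y) \<in> F"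
    and F_scale: "\<And>\<xi> c. \<xi> \<in> F \<Longrightarrow> (\<lambda>y. c * \<xi> y) \<in> F"
    and F_linear: "\<And>\<xi>. \<xi> \<in> F \<Longrightarrow> linear \<xi>"
    and F_cont: "\<And>\<xi>. \<xi> \<in> F \<Longrightarrow> continuous_on E0 \<xi>"
    and F_inj: "\<And>\<xi> \<eta>. \<xi> \<in> F \<Longrightarrow> \<eta> \<in> F \<Longrightarrow> (\<forall>x\<in>E0. \<xi> x = \<eta> x) \<Longrightarrow> \<xi> = \<eta>"
    and F_surj: "\<And>f. (\<forall>x\<in>E0. \<forall>y\<in>E0. f (x + y) = f x + f y) \<Longrightarrow>
                     (\<forall>c. \<forall>x\<in>E0. f (c *\<^sub>R x) = c * f x) \<Longrightarrow> continuous_on E0 f \<Longrightarrow>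
                     \<exists>\<xi>\<in>F. \<forall>x\<in>E0. \<xi> x = f x"
    and F_meas: "\<And>\<xi>. \<xi> \<in> F \<Longrightarrow> \<xi> \<in> borel_measurable ball_sigma"
    \<comment> \<open>speed sequence\<close>
    and a_pos: "\<And>n. a n > 0"
    and a_lim: "filterlim a at_top sequentially"
    \<comment> \<open>random vectors\<close>
    and M_prob: "\<And>n. prob_space (M n)"
    and Y_meas: "\<And>n. Y n \<in> measurable (M n) ball_sigma"
    \<comment> \<open>assumption 1\<close>
    and A1: "\<And>n \<xi>. \<xi> \<in> F \<Longrightarrow> (\<lambda>x. Phin n x \<xi>) \<in> borel_measurable ball_sigma"
    \<comment> \<open>assumption 2\<close>
    and A2_meas: "\<And>\<xi>. \<xi> \<in> F \<Longrightarrow> (\<lambda>x. Phi x \<xi>) \<in> borel_measurable ball_sigma"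
    and A2_cont: "\<And>\<xi>. \<xi> \<in> F \<Longrightarrow> continuous_on UNIV (\<lambda>x. Phi x \<xi>)"
    and A2_zero: "\<And>x. Phi x (\<lambda>y. 0) = 0"
    \<comment> \<open>assumption 3\<close>
    and A3: "\<And>\<xi> K. \<xi> \<in> F \<Longrightarrow> compact K \<Longrightarrow>
               uniform_limit K (\<lambda>n x. Phin n x (\<lambda>y. a n * \<xi> y) / a n) (\<lambda>x. Phi x \<xi>) sequentially"
    \<comment> \<open>assumption 4\<close>
    and A4: "\<And>n \<xi>. \<xi> \<in> F \<Longrightarrow>
               (\<integral>\<^sup>+ \<omega>. ennreal (exp (\<xi> (Y n \<omega>) - Phin n (Y n \<omega>) \<xi>)) \<partial>M n) = 1"
    \<comment> \<open>assumption 5\<close>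
    and A5: "exp_tight M Y a"
    \<comment> \<open>assumption 6\<close>
    and A6: "\<And>\<xi>. \<xi> \<in> F \<Longrightarrow>
               limsup (\<lambda>n. SUP x. ereal \<bar>Phin n x (\<lambda>y. a n * \<xi> y) / a n\<bar>) < \<infinity>"
    \<comment> \<open>assumption 7\<close>
    and A7: "\<And>x. phistar F Phi x x < \<infinity> \<Longrightarrow>
               \<exists>U. open U \<and> x \<in> U \<and>
                 (\<forall>l\<ge>0. (\<Union>y\<in>U. {z. phistar F Phi y z \<le> ereal l}) \<subseteq> E0 \<and>
                         compact (closure (\<Union>y\<in>U. {z. phistar F Phi y z \<le> ereal l})))"
    \<comment> \<open>assumption 8\<close>
    and A8: "\<And>xs x \<xi>s \<xi>. (\<forall>n. xs n \<in> E0) \<Longrightarrow> x \<in> E0 \<Longrightarrow> xs \<longlonglongrightarrow> x \<Longrightarrow>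
               (\<forall>n. \<xi>s n \<in> F) \<Longrightarrow> \<xi> \<in> F \<Longrightarrow> (\<forall>z\<in>E0. (\<lambda>n. \<xi>s n z) \<longlonglongrightarrow> \<xi> z) \<Longrightarrow>
               ereal (Phi x \<xi>) \<le> liminf (\<lambda>n. ereal (Phi (xs n) (\<xi>s n)))"
    \<comment> \<open>assumption 9\<close>
    and A9_convex: "\<And>x \<xi> \<eta> t. \<xi> \<in> F \<Longrightarrow> \<eta> \<in> F \<Longrightarrow> 0 \<le> t \<Longrightarrow> t \<le> 1 \<Longrightarrow>
               Phi x (\<lambda>y. (1 - t) * \<xi> y + t * \<eta> y) \<le> (1 - t) * Phi x \<xi> + t * Phi x \<eta>"
    and A9_diff: "\<And>x \<xi>. \<xi> \<in> F \<Longrightarrow> gateaux_differentiable F E0 (Phi x) \<xi>"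
    and A9_deriv: "\<And>x \<xi>. \<xi> \<in> F \<Longrightarrow> x \<in> E0 \<Longrightarrow>
               continuous_on UNIV (deriv (\<lambda>t. Phi x (\<lambda>y. t * \<xi> y)))"
    \<comment> \<open>assumption 10\<close>
    and A10: "\<And>\<xi>. \<xi> \<in> F \<Longrightarrow>
               \<forall>x\<in>E0. \<forall>x'\<in>E0. x = gateaux_grad F E0 (Phi x) \<xi> \<longrightarrow>
                 x' = gateaux_grad F E0 (Phi x') \<xi> \<longrightarrow> x = x'"
    \<comment> \<open>assumption 11\<close>
    and A11: "\<And>x0 \<epsilon>. phistar F Phi x0 x0 < \<infinity> \<Longrightarrow> \<epsilon> > 0 \<Longrightarrow>
               \<exists>y0\<in>ball x0 \<epsilon>. y0 \<in> E0 \<and>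
                 Limsup (at y0 within E0) (\<lambda>y. phistar F Phi y y0) \<le> phistar F Phi y0 y0 \<and>
                 phistar F Phi y0 y0 \<le> phistar F Phi x0 x0 + ereal \<epsilon>"
  shows "(\<forall>A \<in> sets ball_sigma.
            liminf (\<lambda>n. ereal (1 / a n) * elog (measure (M n) {\<omega>\<in>space (M n). Y n \<omega> \<in> A}))
              \<ge> - (INF x\<in>interior A. phistar F Phi x x))
         \<and> (\<forall>l\<ge>0. compact {x. phistar F Phi x x \<le> ereal l})"
proof -
  interpret ldp_setting E0 F Phi a Phin M Y
    by (intro ldp_setting.intro dual_setting.intro ldp_setting_axioms.intro) (fact assms)+
  have "- (INF x\<in>interior A. phistar F Phi x x)
      \<le> liminf (\<lambda>n. ereal (1 / a n) * elog (measure (M n) {\<omega>\<in>space (M n). Y n \<omega> \<in> A}))"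
    if A: "A \<in> sets ball_sigma" for A
    unfolding measure_law[OF A] ereal_SUP_uminus_eq[symmetric]
    by (intro SUP_least lower_bound[OF A])
  then show ?thesis
    using compact_level_set by blast
qed

end
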